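(* Let $f$ be an exponential on the ordered field $K$ and let $w$ be a coarsening of the natural valuation $v$ of $K$ such that $f$ is compatible with $w$. Then there is no coarsening $\tilde{w}$ of $w$ such that the valuation $\overline{w}=w/\tilde{w}$ induced by $w$ on the residue field $K\tilde{w}$ is nontrivial and $(K\tilde{w},\overline{w})$ is maximal.
   Context: The natural valuation $v$ of an ordered field $(K,<)$ is the valuation sending each nonzero $a$ to its archimedean class $[a]$, where the archimedean classes are ordered by $[a]<[b]$ iff $|a|\gg|b|$ (i.e. $|a|>n|b|$ for all $n\in\mathbb{N}$), with addition $[a]+[b]=[ab]$; its valuation ring is the convex hull of $\mathbb{Z}$ in $K$. For a valuation $w$ on $K$, let $R_w=\{a\in K\mid wa\ge 0\}$ denote its valuation ring, $I_w=\{a\in K\mid wa>0\}$ its valuation ideal, $Kw=R_w/I_w$ its residue field, and ${\mathcal U}_w^{>0}=\{a\in K\mid wa=0,\ a>0\}$. A valuation $w'$ is a coarsening of a valuation $w$ if $R_w\subseteq R_{w'}$ (equality and the trivial valuation are allowed). If $\tilde w$ is a coarsening of $w$, then $w/\tilde w$ denotes the valuation on $K\tilde w=R_{\tilde w}/I_{\tilde w}$ whose valuation ring is the image of $R_w$, i.e. $R_w/I_{\tilde w}$. An exponential on an ordered field $(K,<)$ is an isomorphism $f$ of ordered groups from $(K,+,0,<)$ onto the ordered multiplicative group $(K^{>0},\cdot,1,<)$ of positive elements. It is compatible with $w$ if $f(R_w)={\mathcal U}_w^{>0}$ and $f(I_w)=1+I_w$. A valued field is maximal if it admits no proper immediate extension,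 i.e. no proper valued field extension with the same value group and the same residue field. *)

theory Defs
  imports "HOL-Algebra.Algebra" "HOL-Algebra.Algebraic_Closure_Type"
begin

section \<open>Valuations\<close>

text \<open>
  A valuation is given by its values on the nonzero elements, in the ordered abelian group
  \<open>'g\<close>; the value at \<open>\<zero>\<close> is understood to be infinite, so what the HOL function returns there is
  never used. A valuation need not be onto: its value group is the subgroup \<open>value_group F v\<close>
  of \<open>'g\<close>.
\<close>

definition valuation :: "('b, 'm) ring_scheme \<Rightarrow> ('b \<Rightarrow> 'g::linordered_ab_group_add) \<Rightarrow> bool" where
  "valuation F v \<longleftrightarrow> field F \<and>
     (\<forall>x \<in> carrier F - {\<zero>\<^bsub>F\<^esub>}. \<forall>y \<in> carrier F - {\<zero>\<^bsub>F\<^esub>}. v (x \<otimes>\<^bsub>F\<^esub> y) = v x + v y) \<and>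
     (\<forall>x \<in> carrier F - {\<zero>\<^bsub>F\<^esub>}. \<forall>y \<in> carrier F - {\<zero>\<^bsub>F\<^esub>}.
        x \<oplus>\<^bsub>F\<^esub> y \<noteq> \<zero>\<^bsub>F\<^esub> \<longrightarrow> min (v x) (v y) \<le> v (x \<oplus>\<^bsub>F\<^esub> y))"

definition val_ring :: "('b, 'm) ring_scheme \<Rightarrow> ('b \<Rightarrow> 'g::linordered_ab_group_add) \<Rightarrow> 'b set" where
  "val_ring F v = {a \<in> carrier F. a = \<zero>\<^bsub>F\<^esub> \<or> 0 \<le> v a}"

definition val_ideal :: "('b, 'm) ring_scheme \<Rightarrow> ('b \<Rightarrow> 'g::linordered_ab_group_add) \<Rightarrow> 'b set" where
  "val_ideal F v = {a \<in> carrier F. a = \<zero>\<^bsub>F\<^esub> \<or> 0 < v a}"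

definition residue_field ::
    "('b, 'm) ring_scheme \<Rightarrow> ('b \<Rightarrow> 'g::linordered_ab_group_add) \<Rightarrow> 'b set ring" where
  "residue_field F v = (F\<lparr>carrier := val_ring F v\<rparr>) Quot (val_ideal F v)"

definition residue ::
    "('b, 'm) ring_scheme \<Rightarrow> ('b \<Rightarrow> 'g::linordered_ab_group_add) \<Rightarrow> 'b \<Rightarrow> 'b set" where
  "residue F v a = val_ideal F v +>\<^bsub>F\<^esub> a"

definition value_group ::
    "('b, 'm) ring_scheme \<Rightarrow> ('b \<Rightarrow> 'g::linordered_ab_group_add) \<Rightarrow> 'g set" where
  "value_group F v = v ` (carrier F - {\<zero>\<^bsub>F\<^esub>})"

definition nontrivial_valuation ::
    "('b, 'm) ring_scheme \<Rightarrow> ('b \<Rightarrow> 'g::linordered_ab_group_add) \<Rightarrow> bool" where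
  "nontrivial_valuation F v \<longleftrightarrow> value_group F v \<noteq> {0}"

definition coarsening ::
    "('b, 'm) ring_scheme \<Rightarrow> ('b \<Rightarrow> 'h::linordered_ab_group_add) \<Rightarrow>
     ('b \<Rightarrow> 'g::linordered_ab_group_add) \<Rightarrow> bool" where
  "coarsening F w' w \<longleftrightarrow> valuation F w' \<and> valuation F w \<and> val_ring F w \<subseteq> val_ring F w'"

text \<open>
  The valuation induced by \<open>w\<close> on the residue field of a coarsening \<open>w'\<close> is specified, as usual up to
  equivalence of valuations, by its valuation ring; hence a predicate. It is satisfiable for every
  coarsening, see \<open>induced_valuation_exists\<close> below.
\<close>

definition induced_valuation ::
    "('b, 'm) ring_scheme \<Rightarrow> ('b \<Rightarrow> 'g::linordered_ab_group_add) \<Rightarrow>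
     ('b \<Rightarrow> 'h::linordered_ab_group_add) \<Rightarrow> ('b set \<Rightarrow> 'k::linordered_ab_group_add) \<Rightarrow> bool" where
  "induced_valuation F w w' wb \<longleftrightarrow>
     valuation (residue_field F w') wb \<and>
     val_ring (residue_field F w') wb = residue F w' ` val_ring F w"

context
  fixes F :: "('b, 'm) ring_scheme" (structure) and v :: "'b \<Rightarrow> 'g::linordered_ab_group_add"
  assumes val: "valuation F v"
begin

interpretation field F using val by (simp add: valuation_def)

lemma val_mult: "\<lbrakk>x \<in> carrier F; y \<in> carrier F; x \<noteq> \<zero>; y \<noteq> \<zero>\<rbrakk> \<Longrightarrow> v (x \<otimes> y) = v x + v y"
  using val by (simp add: valuation_def)

lemma val_add: "\<lbrakk>x \<in> carrier F; y \<in> carrier F; x \<noteq> \<zero>; y \<noteq> \<zero>; x \<oplus> y \<noteq> \<zero>\<rbrakk> \<Longrightarrow>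
    min (v x) (v y) \<le> v (x \<oplus> y)"
  using val by (simp add: valuation_def)

lemma val_one: "v \<one> = 0"
  using val_mult[of \<one> \<one>] by simp

lemma val_inv: "\<lbrakk>x \<in> carrier F; x \<noteq> \<zero>\<rbrakk> \<Longrightarrow> inv x \<in> carrier F \<and> inv x \<noteq> \<zero> \<and> v (inv x) = - v x"
proof -
  assume x: "x \<in> carrier F" "x \<noteq> \<zero>"
  then have u: "x \<in> Units F" by (simp add: field_Units)
  then have i: "inv x \<in> carrier F" "x \<otimes> inv x = \<one>" by simp_all
  then have nz: "inv x \<noteq> \<zero>" using x by (metis r_null zero_not_one)
  have "v x + v (inv x) = 0" using val_mult[OF x(1) i(1) x(2) nz] i(2) val_one by simp
  then show ?thesis using i nz by (simp add: eq_neg_iff_add_eq_0 add.commute)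
qed

lemma val_minus: "x \<in> carrier F \<Longrightarrow> x \<noteq> \<zero> \<Longrightarrow> v (\<ominus> x) = v x"
proof -
  assume x: "x \<in> carrier F" "x \<noteq> \<zero>"
  have nz: "\<ominus> \<one> \<noteq> \<zero>" by (metis add.inv_eq_1_iff one_closed zero_not_one)
  have "v (\<ominus> \<one>) + v (\<ominus> \<one>) = 0"
    using val_mult[of "\<ominus> \<one>" "\<ominus> \<one>"] nz val_one by (simp add: l_minus r_minus)
  then have "v (\<ominus> \<one>) = 0" by simp
  then show ?thesis using val_mult[of "\<ominus> \<one>" x] nz x by (simp add: l_minus)
qed

lemma val_ring_subring: "subring (val_ring F v) F"
proof (rule subringI)
  show "\<ominus> h \<in> val_ring F v" if "h \<in> val_ring F v" for h
    using that val_minus[of h] by (cases "h = \<zero>") (auto simp: val_ring_def)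
  show "h1 \<otimes> h2 \<in> val_ring F v" if "h1 \<in> val_ring F v" "h2 \<in> val_ring F v" for h1 h2
    using that val_mult[of h1 h2]
    by (cases "h1 = \<zero>"; cases "h2 = \<zero>") (auto simp: val_ring_def)
  show "h1 \<oplus> h2 \<in> val_ring F v" if "h1 \<in> val_ring F v" "h2 \<in> val_ring F v" for h1 h2
    using that val_add[of h1 h2]
    by (cases "h1 = \<zero>"; cases "h2 = \<zero>"; cases "h1 \<oplus> h2 = \<zero>")
      (auto simp: val_ring_def min_def split: if_splits)
qed (auto simp: val_ring_def val_one)

lemma val_ideal_ideal: "ideal (val_ideal F v) (F\<lparr>carrier := val_ring F v\<rparr>)"
proof -
  interpret R: ring "F\<lparr>carrier := val_ring F v\<rparr>"
    by (rule subring_is_ring[OF val_ring_subring])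
  have sub: "subgroup (val_ideal F v) (add_monoid F)"
  proof (rule add.subgroupI)
    show "\<ominus> h \<in> val_ideal F v" if "h \<in> val_ideal F v" for h
      using that val_minus[of h] by (cases "h = \<zero>") (auto simp: val_ideal_def)
    show "h1 \<oplus> h2 \<in> val_ideal F v" if "h1 \<in> val_ideal F v" "h2 \<in> val_ideal F v" for h1 h2
      using that val_add[of h1 h2]
      by (cases "h1 = \<zero>"; cases "h2 = \<zero>"; cases "h1 \<oplus> h2 = \<zero>")
      (auto simp: val_ideal_def min_def split: if_splits)
  qed (auto simp: val_ideal_def)
  show ?thesis
  proof (rule idealI[OF R.ring_axioms])
    show "subgroup (val_ideal F v) (add_monoid (F\<lparr>carrier := val_ring F v\<rparr>))"
    proof (rule R.add.subgroupI)
      fix h assume h: "h \<in> val_ideal F v"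
      have hr: "h \<in> val_ring F v" and hi: "\<ominus> h \<in> val_ideal F v"
        using h subgroup.m_inv_closed[OF sub h] by (auto simp: val_ideal_def val_ring_def a_inv_def)
      have "\<ominus>\<^bsub>F\<lparr>carrier := val_ring F v\<rparr>\<^esub> h = \<ominus> h"
        by (rule R.minus_equality)
           (use hr hi in \<open>auto simp: val_ideal_def val_ring_def l_neg\<close>)
      then show "\<ominus>\<^bsub>F\<lparr>carrier := val_ring F v\<rparr>\<^esub> h \<in> val_ideal F v" using hi by simp
    qed (use subgroup.m_closed[OF sub] in \<open>auto simp: val_ideal_def val_ring_def\<close>)
  next
    fix a x assume a: "a \<in> val_ideal F v" and x: "x \<in> carrier (F\<lparr>carrier := val_ring F v\<rparr>)"
    have xa: "x \<otimes> a \<in> val_ideal F v"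
      using a x val_mult[of x a]
      by (cases "a = \<zero>"; cases "x = \<zero>")
         (auto simp: val_ideal_def val_ring_def add_nonneg_pos)
    then show "x \<otimes>\<^bsub>F\<lparr>carrier := val_ring F v\<rparr>\<^esub> a \<in> val_ideal F v" by simp
    have "a \<otimes> x = x \<otimes> a" using a x by (auto simp: val_ideal_def val_ring_def m_comm)
    then show "a \<otimes>\<^bsub>F\<lparr>carrier := val_ring F v\<rparr>\<^esub> x \<in> val_ideal F v" using xa by simp
  qed
qed

lemma residue_eq_iff:
  assumes "a \<in> val_ring F v" "b \<in> val_ring F v"
  shows "residue F v a = residue F v b \<longleftrightarrow> a \<ominus> b \<in> val_ideal F v"
proof -
  interpret R: ring "F\<lparr>carrier := val_ring F v\<rparr>"
    by (rule subring_is_ring[OF val_ring_subring])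
  have "\<ominus>\<^bsub>F\<lparr>carrier := val_ring F v\<rparr>\<^esub> b = \<ominus> b"
    by (rule R.minus_equality)
       (use assms subringE(5)[OF val_ring_subring] in \<open>auto simp: val_ring_def l_neg\<close>)
  then show ?thesis
    using R.quotient_eq_iff_same_a_r_cos[OF val_ideal_ideal, of a b] assms
    by (simp add: residue_def a_r_coset_def r_coset_def a_minus_def)
qed

lemma residue_self: "a \<in> val_ring F v \<Longrightarrow> a \<in> residue F v a"
  by (auto simp: residue_def a_r_coset_def r_coset_def val_ideal_def val_ring_def
        intro!: bexI[of _ \<zero>])

lemma residue_field_simps:
  "carrier (residue_field F v) = residue F v ` val_ring F v"
  "\<zero>\<^bsub>residue_field F v\<^esub> = residue F v \<zero>"
  "\<one>\<^bsub>residue_field F v\<^esub> = residue F v \<one>"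
  "\<lbrakk>a \<in> val_ring F v; b \<in> val_ring F v\<rbrakk> \<Longrightarrow>
     residue F v a \<otimes>\<^bsub>residue_field F v\<^esub> residue F v b = residue F v (a \<otimes> b)"
  "\<lbrakk>a \<in> val_ring F v; b \<in> val_ring F v\<rbrakk> \<Longrightarrow>
     residue F v a \<oplus>\<^bsub>residue_field F v\<^esub> residue F v b = residue F v (a \<oplus> b)"
proof -
  interpret I: ideal "val_ideal F v" "F\<lparr>carrier := val_ring F v\<rparr>" by (rule val_ideal_ideal)
  have coset: "a_r_coset (F\<lparr>carrier := val_ring F v\<rparr>) = a_r_coset F"
    by (intro ext) (simp add: a_r_coset_def r_coset_def)
  show "carrier (residue_field F v) = residue F v ` val_ring F v"
    by (auto simp: residue_field_def residue_def[abs_def] FactRing_def A_RCOSETS_def RCOSETS_def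
        a_r_coset_def r_coset_def)
  have "residue F v \<zero> = val_ideal F v"
    using I.a_rcos_const[of \<zero>] by (simp add: residue_def coset val_ideal_def)
  then show "\<zero>\<^bsub>residue_field F v\<^esub> = residue F v \<zero>"
    by (simp add: residue_field_def FactRing_def)
  show "\<one>\<^bsub>residue_field F v\<^esub> = residue F v \<one>"
    by (auto simp: residue_field_def residue_def FactRing_simps coset)
  show "residue F v a \<otimes>\<^bsub>residue_field F v\<^esub> residue F v b = residue F v (a \<otimes> b)"
    if "a \<in> val_ring F v" "b \<in> val_ring F v"
    using I.rcoset_mult_add[of a b] that
    by (simp add: residue_field_def residue_def FactRing_def coset)
  show "residue F v a \<oplus>\<^bsub>residue_field F v\<^esub> residue F v b = residue F v (a \<oplus> b)"
    if "a \<in> val_ring F v" "b \<in> val_ring F v"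
    using I.a_rcos_sum[of a b] that
    by (simp add: residue_field_def residue_def FactRing_def coset)
qed

lemma residue_zero_iff:
  "a \<in> val_ring F v \<Longrightarrow> residue F v a = residue F v \<zero> \<longleftrightarrow> a \<in> val_ideal F v"
  by (subst residue_eq_iff) (auto simp: val_ring_def a_minus_def)

lemma residue_field_field: "field (residue_field F v)"
proof -
  have "cring (F\<lparr>carrier := val_ring F v\<rparr>)"
    using subcring_iff[of "val_ring F v"] subcringI'[OF val_ring_subring] subringE(1)[OF val_ring_subring]
    by simp
  then have "cring (residue_field F v)"
    unfolding residue_field_def by (rule ideal.quotient_is_cring[OF val_ideal_ideal])
  then interpret Q: cring "residue_field F v" .
  have one: "\<one> \<in> val_ring F v" "\<one> \<notin> val_ideal F v" by (auto simp: val_ring_def val_ideal_def val_one)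
  show ?thesis
  proof (rule Q.cring_fieldI2)
    show "\<zero>\<^bsub>residue_field F v\<^esub> \<noteq> \<one>\<^bsub>residue_field F v\<^esub>"
      using one residue_zero_iff[of \<one>] by (metis residue_field_simps(2,3))
    fix A assume A: "A \<in> carrier (residue_field F v)" "A \<noteq> \<zero>\<^bsub>residue_field F v\<^esub>"
    obtain a where a: "a \<in> val_ring F v" "A = residue F v a"
      using A(1) unfolding residue_field_simps(1) by (rule imageE)
    have "a \<notin> val_ideal F v"
      using A(2) unfolding a(2) residue_field_simps(2) residue_zero_iff[OF a(1)] .
    note a = a this
    then have a': "a \<in> carrier F" "a \<noteq> \<zero>" "v a = 0"
      by (auto simp: val_ring_def val_ideal_def)
    then have i: "inv a \<in> val_ring F v" using val_inv[of a] by (simp add: val_ring_def)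
    have "a \<otimes> inv a = \<one>" using a' by (simp add: field_Units)
    then show "\<exists>B\<in>carrier (residue_field F v). A \<otimes>\<^bsub>residue_field F v\<^esub> B = \<one>\<^bsub>residue_field F v\<^esub>"
      using a i by (intro bexI[of _ "residue F v (inv a)"])
        (auto simp: residue_field_simps(1,3,4))
  qed
qed

lemma val_add_eq:
  assumes "x \<in> carrier F" "y \<in> carrier F" "x \<noteq> \<zero>" "y = \<zero> \<or> v x < v y"
  shows "x \<oplus> y \<noteq> \<zero> \<and> v (x \<oplus> y) = v x"
proof (cases "y = \<zero>")
  case False
  then have lt: "v x < v y" using assms by simp
  have nz: "x \<oplus> y \<noteq> \<zero>"
  proof
    assume "x \<oplus> y = \<zero>"
    then have "x = \<ominus> y" using assms by (simp add: minus_equality)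
    then show False using lt val_minus[of y] assms False by simp
  qed
  have "x = (x \<oplus> y) \<oplus> \<ominus> y" using assms by (simp add: a_assoc r_neg)
  then have "min (v (x \<oplus> y)) (v y) \<le> v x"
    using val_add[of "x \<oplus> y" "\<ominus> y"] val_minus[of y] assms nz False by auto
  moreover have "v x \<le> v (x \<oplus> y)" using val_add[of x y] assms nz False lt by auto
  ultimately show ?thesis using nz lt by (auto simp: min_def split: if_splits)
qed (use assms in simp)

end

lemma induced_valuation_exists:
  fixes F :: "('b, 'm) ring_scheme" (structure) and w :: "'b \<Rightarrow> 'g::linordered_ab_group_add"
  assumes "coarsening F w' w"
  shows "\<exists>wb :: 'b set \<Rightarrow> 'g. induced_valuation F w w' wb"
proof -
  have w': "valuation F w'" and w: "valuation F w" and sub: "val_ring F w \<subseteq> val_ring F w'"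
    using assms by (auto simp: coarsening_def)
  interpret field F using w by (simp add: valuation_def)
  note simps = residue_field_simps[OF w']
  have ideal: "val_ideal F w' \<subseteq> val_ideal F w"
  proof
    fix x assume x: "x \<in> val_ideal F w'"
    show "x \<in> val_ideal F w"
    proof (rule ccontr)
      assume nx: "x \<notin> val_ideal F w"
      then have x': "x \<in> carrier F" "x \<noteq> \<zero>" "0 < w' x" "w x \<le> 0"
        using x by (auto simp: val_ideal_def)
      then have "inv x \<in> val_ring F w" using val_inv[OF w, of x] by (simp add: val_ring_def)
      then have "inv x \<in> val_ring F w'" using sub by blast
      then show False using val_inv[OF w', of x] x' by (simp add: val_ring_def)
    qed
  qed
  define wb where "wb C = w (SOME a. a \<in> val_ring F w' \<and> C = residue F w' a)" for C
  have wb: "wb (residue F w' a) = w a" if a: "a \<in> val_ring F w'" "a \<notin> val_ideal F w'" for a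
  proof -
    define b where "b = (SOME b. b \<in> val_ring F w' \<and> residue F w' a = residue F w' b)"
    have b: "b \<in> val_ring F w'" "residue F w' a = residue F w' b"
      unfolding b_def using someI[of "\<lambda>b. b \<in> val_ring F w' \<and> residue F w' a = residue F w' b" a] a
      by blast+
    have a': "a \<in> carrier F" "a \<noteq> \<zero>" "w' a = 0" using a by (auto simp: val_ring_def val_ideal_def)
    have bc: "b \<in> carrier F" using b by (simp add: val_ring_def)
    define i where "i = b \<ominus> a"
    have i: "i \<in> val_ideal F w'" "i \<in> carrier F" "b = a \<oplus> i"
      using residue_eq_iff[OF w' b(1) a(1)] b(2) a' bc a_lcomm[of a b "\<ominus> a"]
      by (auto simp: i_def a_minus_def r_neg)
    have "i = \<zero> \<or> w a < w i"
    proof (cases "i = \<zero>")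
      case False
      have inva: "inv a \<in> carrier F" "inv a \<noteq> \<zero>" "w' (inv a) = 0" "w (inv a) = - w a"
        using val_inv[OF w', of a] val_inv[OF w, of a] a' by auto
      have "i \<otimes> inv a \<in> val_ideal F w'"
        using i False inva by (auto simp: val_ideal_def val_mult[OF w'])
      then have "i \<otimes> inv a \<in> val_ideal F w" using ideal by blast
      then have "0 < w i - w a"
        using False inva i by (auto simp: val_ideal_def val_mult[OF w] integral_iff)
      then show ?thesis by simp
    qed simp
    then have "w b = w a" using val_add_eq[OF w a'(1) i(2) a'(2)] i(3) by simp
    then show ?thesis by (simp add: wb_def b_def)
  qed
  have rep: "\<exists>a. a \<in> val_ring F w' \<and> a \<notin> val_ideal F w' \<and> a \<in> carrier F \<and> a \<noteq> \<zero> \<and> A = residue F w' a"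
    if "A \<in> carrier (residue_field F w') - {\<zero>\<^bsub>residue_field F w'\<^esub>}" for A
  proof -
    have A: "A \<in> carrier (residue_field F w')" "A \<noteq> \<zero>\<^bsub>residue_field F w'\<^esub>" using that by auto
    obtain a where a: "a \<in> val_ring F w'" "A = residue F w' a"
      using A(1) unfolding simps(1) by (rule imageE)
    have "a \<notin> val_ideal F w'"
      using A(2) unfolding a(2) simps(2) residue_zero_iff[OF w' a(1)] .
    note a = a this
    then show ?thesis by (intro exI[of _ a]) (auto simp: val_ring_def val_ideal_def)
  qed
  interpret Q: field "residue_field F w'" by (rule residue_field_field[OF w'])
  have zero: "A \<noteq> \<zero>\<^bsub>residue_field F w'\<^esub> \<longleftrightarrow> a \<notin> val_ideal F w'"
    if "a \<in> val_ring F w'" "A = residue F w' a" for a A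
    using that by (simp add: simps(2) residue_zero_iff[OF w'])
  have "valuation (residue_field F w') wb"
    unfolding valuation_def
  proof (intro conjI ballI impI)
    show "field (residue_field F w')" by (rule residue_field_field[OF w'])
  next
    fix A B
    assume A: "A \<in> carrier (residue_field F w') - {\<zero>\<^bsub>residue_field F w'\<^esub>}"
      and B: "B \<in> carrier (residue_field F w') - {\<zero>\<^bsub>residue_field F w'\<^esub>}"
    obtain a b where a: "a \<in> val_ring F w'" "a \<notin> val_ideal F w'" "a \<in> carrier F" "a \<noteq> \<zero>" "A = residue F w' a"
      and b: "b \<in> val_ring F w'" "b \<notin> val_ideal F w'" "b \<in> carrier F" "b \<noteq> \<zero>" "B = residue F w' b"
      using rep[OF A] rep[OF B] by blast
    have AB: "A \<otimes>\<^bsub>residue_field F w'\<^esub> B = residue F w' (a \<otimes> b)"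
      "A \<oplus>\<^bsub>residue_field F w'\<^esub> B = residue F w' (a \<oplus> b)"
      using a b by (simp_all add: simps(4,5))
    have mr: "a \<otimes> b \<in> val_ring F w'" "a \<oplus> b \<in> val_ring F w'"
      using subringE(6,7)[OF val_ring_subring[OF w']] a b by auto
    have "A \<otimes>\<^bsub>residue_field F w'\<^esub> B \<noteq> \<zero>\<^bsub>residue_field F w'\<^esub>"
      using A B by (simp add: Q.integral_iff)
    then have "a \<otimes> b \<notin> val_ideal F w'" using zero[OF mr(1) AB(1)] by simp
    then show "wb (A \<otimes>\<^bsub>residue_field F w'\<^esub> B) = wb A + wb B"
      unfolding AB(1) using a b mr by (simp add: wb val_mult[OF w])
    assume "A \<oplus>\<^bsub>residue_field F w'\<^esub> B \<noteq> \<zero>\<^bsub>residue_field F w'\<^esub>"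
    then have n: "a \<oplus> b \<notin> val_ideal F w'" using zero[OF mr(2) AB(2)] by simp
    then have "a \<oplus> b \<noteq> \<zero>" by (auto simp: val_ideal_def)
    then show "min (wb A) (wb B) \<le> wb (A \<oplus>\<^bsub>residue_field F w'\<^esub> B)"
      using val_add[OF w a(3) b(3) a(4) b(4)] a b mr n unfolding AB(2) by (simp add: wb)
  qed
  moreover have "val_ring (residue_field F w') wb = residue F w' ` val_ring F w"
  proof (rule equalityI; rule subsetI)
    fix A assume A: "A \<in> val_ring (residue_field F w') wb"
    show "A \<in> residue F w' ` val_ring F w"
    proof (cases "A = \<zero>\<^bsub>residue_field F w'\<^esub>")
      case True
      then show ?thesis by (auto simp: simps(2) val_ring_def)
    next
      case False
      then have "A \<in> carrier (residue_field F w') - {\<zero>\<^bsub>residue_field F w'\<^esub>}" "0 \<le> wb A"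
        using A by (auto simp: val_ring_def)
      with rep[of A] obtain a where a: "a \<in> val_ring F w'" "a \<notin> val_ideal F w'" "a \<in> carrier F"
        "A = residue F w' a" by blast
      then show ?thesis using \<open>0 \<le> wb A\<close> by (auto simp: wb val_ring_def)
    qed
  next
    fix A assume "A \<in> residue F w' ` val_ring F w"
    then obtain a where a: "a \<in> val_ring F w" "A = residue F w' a" by blast
    then have ar: "a \<in> val_ring F w'" using sub by blast
    show "A \<in> val_ring (residue_field F w') wb"
    proof (cases "a \<in> val_ideal F w'")
      case True
      then show ?thesis using zero[OF ar a(2)] by (auto simp: val_ring_def)
    next
      case False
      then have "0 \<le> wb A" using a ar wb[OF ar False] by (auto simp: val_ring_def val_ideal_def)
      then show ?thesis using a ar by (auto simp: val_ring_def simps(1))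
    qed
  qed
  ultimately show ?thesis unfolding induced_valuation_def by blast
qed

section \<open>Maximal valued fields\<close>

text \<open>
  The value group of \<open>F\<close> is identified with its image in the value group of the extension \<open>L\<close>.
\<close>

definition valued_extension ::
    "('b, 'm) ring_scheme \<Rightarrow> ('b \<Rightarrow> 'g::linordered_ab_group_add) \<Rightarrow>
     ('c, 'n) ring_scheme \<Rightarrow> ('c \<Rightarrow> 'g) \<Rightarrow> ('b \<Rightarrow> 'c) \<Rightarrow> bool" where
  "valued_extension F v L u h \<longleftrightarrow>
     valuation F v \<and> valuation L u \<and> h \<in> ring_hom F L \<and>
     (\<forall>x \<in> carrier F - {\<zero>\<^bsub>F\<^esub>}. u (h x) = v x)"

text \<open>
  The last conjunct says that the canonical embedding of residue fields, sending the residue of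
  \<open>a\<close> to that of \<open>h a\<close>, is onto.
\<close>

definition immediate_extension ::
    "('b, 'm) ring_scheme \<Rightarrow> ('b \<Rightarrow> 'g::linordered_ab_group_add) \<Rightarrow>
     ('c, 'n) ring_scheme \<Rightarrow> ('c \<Rightarrow> 'g) \<Rightarrow> ('b \<Rightarrow> 'c) \<Rightarrow> bool" where
  "immediate_extension F v L u h \<longleftrightarrow>
     valued_extension F v L u h \<and>
     value_group L u = value_group F v \<and>
     carrier (residue_field L u) = (\<lambda>a. residue L u (h a)) ` val_ring F v"

text \<open>
  HOL cannot quantify over all types inside a formula, so extensions are taken with carrier in the
  type \<open>'b set\<close>. This is no restriction up to isomorphism: an immediate extension of a valued field
  with residue field \<open>k\<close> and value group \<open>\<Gamma>\<close> has cardinality at most \<open>|k|\<close> to the power \<open>|\<Gamma>|\<close>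
  (Krull, Gravett), and \<open>|k|\<close> and \<open>|\<Gamma>|\<close> are at most the cardinality of \<open>'b\<close>; if \<open>'b\<close> is finite, every
  valuation on \<open>F\<close> is trivial and there is no proper immediate extension.
  Similarly, the value group of an immediate extension is that of \<open>F\<close>, so it lives in \<open>'g\<close>.
\<close>

definition maximal_valued_field ::
    "('b, 'm) ring_scheme \<Rightarrow> ('b \<Rightarrow> 'g::linordered_ab_group_add) \<Rightarrow> bool" where
  "maximal_valued_field F v \<longleftrightarrow> valuation F v \<and>
     \<not> (\<exists>(L :: 'b set ring) (u :: 'b set \<Rightarrow> 'g) (h :: 'b \<Rightarrow> 'b set).
          immediate_extension F v L u h \<and> h ` carrier F \<noteq> carrier L)"

section \<open>The natural valuation of an ordered field\<close>

definition much_greater :: "'a::linordered_field \<Rightarrow> 'a \<Rightarrow> bool" (infix "\<ggreater>" 50) where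
  "a \<ggreater> b \<longleftrightarrow> (\<forall>n::nat. \<bar>a\<bar> > of_nat n * \<bar>b\<bar>)"

definition arch_equiv :: "'a::linordered_field \<Rightarrow> 'a \<Rightarrow> bool" where
  "arch_equiv a b \<longleftrightarrow> a \<noteq> 0 \<and> b \<noteq> 0 \<and> \<not> a \<ggreater> b \<and> \<not> b \<ggreater> a"

lemma not_much_greater_iff: "\<not> a \<ggreater> b \<longleftrightarrow> (\<exists>n::nat. \<bar>a\<bar> \<le> of_nat n * \<bar>b\<bar>)"
  by (auto simp: much_greater_def not_less)

lemma not_much_greater_trans:
  assumes "\<not> a \<ggreater> b" "\<not> b \<ggreater> c" shows "\<not> a \<ggreater> c"
proof -
  obtain m n :: nat where mn: "\<bar>a\<bar> \<le> of_nat m * \<bar>b\<bar>" "\<bar>b\<bar> \<le> of_nat n * \<bar>c\<bar>"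
    using assms by (auto simp: not_much_greater_iff)
  have "\<bar>a\<bar> \<le> of_nat m * (of_nat n * \<bar>c\<bar>)"
    using mn(1) mult_left_mono[OF mn(2), of "of_nat m"] by simp
  then have "\<bar>a\<bar> \<le> of_nat (m * n) * \<bar>c\<bar>" by (simp add: mult.assoc)
  then show ?thesis unfolding not_much_greater_iff by blast
qed

lemma not_much_greater_mult:
  assumes "\<not> a \<ggreater> b" "\<not> c \<ggreater> d" shows "\<not> (a * c) \<ggreater> (b * d)"
proof -
  obtain m n :: nat where mn: "\<bar>a\<bar> \<le> of_nat m * \<bar>b\<bar>" "\<bar>c\<bar> \<le> of_nat n * \<bar>d\<bar>"
    using assms by (auto simp: not_much_greater_iff)
  have "\<bar>a\<bar> * \<bar>c\<bar> \<le> (of_nat m * \<bar>b\<bar>) * (of_nat n * \<bar>d\<bar>)"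
    by (rule mult_mono) (use mn in auto)
  then have "\<bar>a * c\<bar> \<le> of_nat (m * n) * \<bar>b * d\<bar>" by (simp add: abs_mult mult_ac)
  then show ?thesis unfolding not_much_greater_iff by blast
qed

lemma not_much_greater_refl: "\<not> a \<ggreater> a"
  unfolding not_much_greater_iff by (rule exI[of _ 1]) simp

lemma much_greater_asym: "\<not> a \<ggreater> b \<or> \<not> b \<ggreater> a"
  unfolding much_greater_def by (metis less_asym mult_1 of_nat_1)

lemma not_much_greater_inverse:
  assumes "\<not> a \<ggreater> b" "a \<noteq> 0" "b \<noteq> 0" shows "\<not> inverse b \<ggreater> inverse a"
proof -
  have "\<not> a * (inverse a * inverse b) \<ggreater> b * (inverse a * inverse b)"
    by (rule not_much_greater_mult[OF assms(1) not_much_greater_refl])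
  then show ?thesis using assms(2,3) by (simp add: field_simps)
qed

quotient_type (overloaded) 'a arch_class = "'a::linordered_field" / partial: arch_equiv
  morphisms rep_arch_class arch_class
proof (rule part_equivpI)
  show "\<exists>x::'a. arch_equiv x x"
    by (rule exI[of _ 1]) (simp add: arch_equiv_def not_much_greater_refl)
  show "symp (arch_equiv :: 'a \<Rightarrow> _)" by (auto simp: symp_def arch_equiv_def)
  show "transp (arch_equiv :: 'a \<Rightarrow> _)"
    by (auto simp: transp_def arch_equiv_def intro: not_much_greater_trans)
      (metis not_much_greater_trans)+
qed

instantiation arch_class :: (linordered_field) linordered_ab_group_add
begin

lift_definition zero_arch_class :: "'a arch_class" is 1
  by (simp add: arch_equiv_def not_much_greater_refl)

lift_definition plus_arch_class :: "'a arch_class \<Rightarrow> 'a arch_class \<Rightarrow> 'a arch_class" is "(*)"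
  by (simp add: arch_equiv_def not_much_greater_mult)

lift_definition uminus_arch_class :: "'a arch_class \<Rightarrow> 'a arch_class" is inverse
  by (simp add: arch_equiv_def not_much_greater_inverse)

definition minus_arch_class :: "'a arch_class \<Rightarrow> 'a arch_class \<Rightarrow> 'a arch_class" where
  "minus_arch_class x y = x + - y"

lift_definition less_arch_class :: "'a arch_class \<Rightarrow> 'a arch_class \<Rightarrow> bool" is "(\<ggreater>)"
  unfolding arch_equiv_def by (metis not_much_greater_trans)

definition less_eq_arch_class :: "'a arch_class \<Rightarrow> 'a arch_class \<Rightarrow> bool" where
  "less_eq_arch_class x y \<longleftrightarrow> x < y \<or> x = y"

instance
proof
  have le: "x \<le> y \<longleftrightarrow> \<not> y < x" for x y :: "'a arch_class"
    unfolding less_eq_arch_class_def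
    by transfer (use much_greater_asym in \<open>auto simp: arch_equiv_def\<close>)
  fix x y z :: "'a arch_class"
  show "x + y + z = x + (y + z)"
    by transfer (simp add: mult.assoc arch_equiv_def not_much_greater_refl)
  show "x + y = y + x"
    by transfer (simp add: mult.commute arch_equiv_def not_much_greater_refl)
  show "0 + x = x"
    by transfer (simp add: arch_equiv_def not_much_greater_refl)
  show "- x + x = 0"
    by transfer (simp add: arch_equiv_def not_much_greater_refl)
  show "x - y = x + - y" by (simp add: minus_arch_class_def)
  have asym: "x < y \<Longrightarrow> \<not> y < x" for x y :: "'a arch_class"
    by transfer (use much_greater_asym in blast)
  show "x < y \<longleftrightarrow> x \<le> y \<and> \<not> y \<le> x" unfolding le using asym by blast
  show "x \<le> x" by (simp add: less_eq_arch_class_def)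
  show "x \<le> z" if "x \<le> y" "y \<le> z"
    using that unfolding le by transfer (metis not_much_greater_trans)
  show "x = y" if "x \<le> y" "y \<le> x"
    using that unfolding le by (auto simp: less_eq_arch_class_def le[symmetric])
  show "x \<le> y \<or> y \<le> x" unfolding le using asym by blast
  show "z + x \<le> z + y" if "x \<le> y"
    using that unfolding le
    by transfer (metis not_much_greater_mult not_much_greater_refl)
qed

end

definition natural_valuation :: "'a::linordered_field \<Rightarrow> 'a arch_class" where
  "natural_valuation a = arch_class a"

lemma natural_valuation_valuation:
  "valuation ring_of_type_algebra (natural_valuation :: 'a::linordered_field \<Rightarrow> _)"
proof -
  have refl: "arch_equiv a a" if "a \<noteq> 0" for a :: 'a
    using that by (simp add: arch_equiv_def not_much_greater_refl)
  have mult: "natural_valuation (x * y) = natural_valuation x + natural_valuation y"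
    if "x \<noteq> 0" "y \<noteq> 0" for x y :: 'a
    unfolding natural_valuation_def
    using that by (simp add: plus_arch_class.abs_eq refl)
  have less: "natural_valuation x < natural_valuation y \<longleftrightarrow> x \<ggreater> y"
    if "x \<noteq> 0" "y \<noteq> 0" for x y :: 'a
    unfolding natural_valuation_def
    using that by (simp add: less_arch_class.abs_eq refl)
  have add: "min (natural_valuation x) (natural_valuation y) \<le> natural_valuation (x + y)"
    if nz: "x \<noteq> 0" "y \<noteq> 0" "x + y \<noteq> 0" for x y :: 'a
  proof (rule ccontr)
    assume "\<not> ?thesis"
    then have "natural_valuation (x + y) < natural_valuation x"
      "natural_valuation (x + y) < natural_valuation y"
      by (simp_all add: not_le min_less_iff_conj)
    then have "x + y \<ggreater> x" "x + y \<ggreater> y" using less nz by auto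
    then have "\<bar>x + y\<bar> > of_nat 2 * \<bar>x\<bar>" "\<bar>x + y\<bar> > of_nat 2 * \<bar>y\<bar>"
      unfolding much_greater_def by blast+
    then show False using abs_triangle_ineq[of x y] by simp
  qed
  show ?thesis
    unfolding valuation_def using mult add
    by (auto simp: field_from_type_algebra) (auto simp: ring_of_type_algebra_def)
qed

lemma val_ring_natural_valuation:
  "val_ring ring_of_type_algebra (natural_valuation :: 'a::linordered_field \<Rightarrow> _) =
     {a. \<exists>m n :: int. of_int m \<le> a \<and> a \<le> of_int n}" (is "_ = ?C")
proof -
  have refl: "arch_equiv a a" if "a \<noteq> 0" for a :: 'a
    using that by (simp add: arch_equiv_def not_much_greater_refl)
  have "val_ring ring_of_type_algebra (natural_valuation :: 'a \<Rightarrow> _) = {a. \<not> a \<ggreater> 1}"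
  proof -
    have "0 \<le> natural_valuation a \<longleftrightarrow> \<not> a \<ggreater> 1" if "a \<noteq> 0" for a :: 'a
      unfolding natural_valuation_def zero_arch_class_def not_less[symmetric]
      using that by (simp add: less_arch_class.abs_eq refl)
    moreover have "\<not> 0 \<ggreater> (1 :: 'a)" by (auto simp: not_much_greater_iff intro: exI[of _ 0])
    ultimately have "a = 0 \<or> 0 \<le> natural_valuation a \<longleftrightarrow> \<not> a \<ggreater> 1" for a :: 'a
      by (cases "a = 0") auto
    then show ?thesis by (simp add: val_ring_def ring_of_type_algebra_def)
  qed
  also have "\<dots> = ?C"
  proof -
    have "\<exists>m n :: int. of_int m \<le> a \<and> a \<le> of_int n" if "\<bar>a\<bar> \<le> of_nat n" for a :: 'a and n
      using that by (intro exI[of _ "- int n"] exI[of _ "int n"]) (auto simp: abs_le_iff)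
    moreover have "\<exists>k::nat. \<bar>a\<bar> \<le> of_nat k"
      if mn: "of_int m \<le> a" "a \<le> of_int n" for a :: 'a and m n :: int
    proof -
      define k where "k = nat (max \<bar>m\<bar> \<bar>n\<bar>)"
      have "n \<le> int k" "- int k \<le> m" by (auto simp: k_def)
      then have "of_int n \<le> (of_int (int k) :: 'a)" "of_int (- int k) \<le> (of_int m :: 'a)"
        by (simp_all only: of_int_le_iff)
      then have "\<bar>a\<bar> \<le> of_nat k" using mn by (auto simp: abs_le_iff)
      then show ?thesis by blast
    qed
    ultimately have "(\<exists>k::nat. \<bar>a\<bar> \<le> of_nat k) \<longleftrightarrow> (\<exists>m n :: int. of_int m \<le> a \<and> a \<le> of_int n)"
      for a :: 'a
      by blast
    then show ?thesis unfolding not_much_greater_iff by simp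
  qed
  finally show ?thesis .
qed

section \<open>Exponentials\<close>

definition exponential :: "('a::linordered_field \<Rightarrow> 'a) \<Rightarrow> bool" where
  "exponential f \<longleftrightarrow> bij_betw f UNIV {0<..} \<and>
     (\<forall>x y. f (x + y) = f x * f y) \<and> (\<forall>x y. x < y \<longleftrightarrow> f x < f y)"

definition compatible ::
    "('a::linordered_field \<Rightarrow> 'a) \<Rightarrow> ('a \<Rightarrow> 'g::linordered_ab_group_add) \<Rightarrow> bool" where
  "compatible f w \<longleftrightarrow>
     f ` val_ring ring_of_type_algebra w = {a. w a = 0 \<and> a > 0} \<and>
     f ` val_ideal ring_of_type_algebra w = (\<lambda>a. 1 + a) ` val_ideal ring_of_type_algebra w"

end

theory Submission
  imports Defs "HOL-Library.Product_Lexorder" "HOL-Library.Product_Plus"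
begin

text \<open>
  The exponential turns elements into values: \<open>x \<mapsto> w (f x)\<close> is an order-reversing homomorphism of \<open>K\<close>
  onto the value group of \<open>w\<close> whose kernel is the valuation ring. So every infinitely large \<open>x > 0\<close>
  is at the same time the name of a value, and \<open>f x\<close> is an element having that value. If
  pseudo-limits existed, infinite sums of such elements would again name values, those would be values
  of further summands, and the process could be continued for longer than \<open>K\<close> has elements. This is
  the argument of F.-V. Kuhlmann, S. Kuhlmann and Shelah against exponentials on power series fields.

  To make it precise without ordinals, call a sequence \<open>\<sigma>\<close> a tower if each \<open>f (\<sigma> (n + 1))\<close> is
  infinitely large but infinitely smaller than \<open>\<sigma> n\<close>. A tower \<open>\<sigma>\<close> descends to \<open>\<tau>\<close> if
  \<open>\<sigma> n - \<tau> n\<close> is, up to smaller terms, equal to \<open>f (\<sigma> (n + 1))\<close>, for all \<open>n\<close> simultaneously.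
  The index is shifted because \<open>f (\<sigma> n)\<close> itself may be larger than \<open>\<sigma> n\<close>. After such a step the
  sequence is again a tower, and its values \<open>w (f (\<tau> n))\<close> have strictly increased, so descending is a
  strict partial order in which nothing is maximal (\<open>descends_tower\<close>, \<open>descends_trans\<close>,
  \<open>descends_exists\<close>). A chain of towers determines, in each coordinate, a nest of balls, and a common
  point of the nest is the corresponding entry of a tower below the whole chain. If all nests have
  common points, this contradicts Zorn's lemma (\<open>no_tower_if_chains_bounded\<close>). For nontrivial
  \<open>w'\<close> one also asks \<open>w' (f (\<sigma> n)) = 0\<close>, which keeps the radii in the value group of the
  induced valuation on \<open>Kw'\<close>; nontriviality of that valuation provides a first tower
  (\<open>tower_exists\<close>).

  It remains to see that maximality of \<open>Kw'\<close> gives common points (\<open>maximal_residue_ball_nest\<close>), which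
  is the hard half of a theorem of Kaplansky. Given a nest without common point, every polynomial
  \<open>q\<close> of small degree has an approximant: an element \<open>a\<close> of \<open>K\<close> such that \<open>q x\<close> and \<open>a\<close> agree up to smaller
  terms for all \<open>x\<close> far inside the nest. Let \<open>p\<close> be a polynomial of least degree without approximant,
  or \<open>0\<close> if there is none. Then approximants are multiplicative modulo \<open>p\<close> (\<open>lead_mult\<close>), and
  \<open>K[X]/(p)\<close>, respectively \<open>K(X)\<close>, is an immediate extension of \<open>K\<close> in which \<open>X\<close> is a common point of
  the nest. Both cases are treated at once, and the passage to the residue field of \<open>w'\<close> is made at the
  same time: \<open>K(X)\<close> carries the valuation composed of the \<open>p\<close>-adic one and the one read off from
  approximants by \<open>w'\<close>, and the residue field of this composite is a proper immediate extension of \<open>Kw'\<close>.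
\<close>

section \<open>Valuations on a field type\<close>

lemma ring_of_type_algebra_simps [simp]:
  "carrier ring_of_type_algebra = UNIV"
  "\<zero>\<^bsub>ring_of_type_algebra\<^esub> = 0" "\<one>\<^bsub>ring_of_type_algebra\<^esub> = 1"
  "x \<otimes>\<^bsub>ring_of_type_algebra\<^esub> y = x * y" "x \<oplus>\<^bsub>ring_of_type_algebra\<^esub> y = x + y"
  by (simp_all add: ring_of_type_algebra_def)

lemma a_minus_type_algebra [simp]:
  "x \<ominus>\<^bsub>ring_of_type_algebra\<^esub> y = (x::'a::field) - y"
proof -
  interpret R: field "ring_of_type_algebra :: 'a ring" by (rule field_from_type_algebra)
  have "\<ominus>\<^bsub>ring_of_type_algebra\<^esub> y = - y"
    by (rule R.minus_equality) simp_all
  then show ?thesis by (simp add: a_minus_def)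
qed

lemma val_ring_type: "val_ring ring_of_type_algebra v = {a. a = 0 \<or> 0 \<le> v a}"
  and val_ideal_type: "val_ideal ring_of_type_algebra v = {a. a = 0 \<or> 0 < v a}"
  by (simp_all add: val_ring_def val_ideal_def)

text \<open>
  By multiplicativity the ultrametric inequality only has to be checked for sums \<open>1 + z\<close>.
\<close>

lemma valuation_typeI:
  fixes v :: "'a::field \<Rightarrow> 'g::linordered_ab_group_add"
  assumes mult: "\<And>x y. x \<noteq> 0 \<Longrightarrow> y \<noteq> 0 \<Longrightarrow> v (x * y) = v x + v y"
    and add_one: "\<And>z. z \<noteq> 0 \<Longrightarrow> 1 + z \<noteq> 0 \<Longrightarrow> 0 \<le> v z \<Longrightarrow> 0 \<le> v (1 + z)"
  shows "valuation ring_of_type_algebra v"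
proof -
  have le: "v x \<le> v (x + y)" if "x \<noteq> 0" "y \<noteq> 0" "x + y \<noteq> 0" "v x \<le> v y" for x y
  proof -
    have eq: "x + y = x * (1 + y / x)" using that by (simp add: field_simps)
    have "v x + v (y / x) = v y" using mult[of x "y / x"] that by simp
    then have "v x + v (y / x) \<ge> v x + 0" using that by simp
    then have "0 \<le> v (y / x)" unfolding add_le_cancel_left .
    moreover have "1 + y / x \<noteq> 0" using eq that by auto
    ultimately have "0 \<le> v (1 + y / x)" using that by (intro add_one) auto
    then have "v x + 0 \<le> v x + v (1 + y / x)" by (rule add_left_mono)
    then show ?thesis using mult[of x "1 + y / x"] \<open>1 + y / x \<noteq> 0\<close> that eq by simp
  qed
  have "min (v x) (v y) \<le> v (x + y)" if "x \<noteq> 0" "y \<noteq> 0" "x + y \<noteq> 0" for x y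
    using le[of x y] le[of y x] that by (auto simp: min_def add.commute)
  then show ?thesis by (simp add: valuation_def field_from_type_algebra mult)
qed

text \<open>
  The value of \<open>0\<close> is infinite by convention, but the function \<open>v\<close> has some arbitrary value there.
  The relation ``\<open>x\<close> is infinitely smaller than \<open>y\<close>'' hides this, and almost everything below is
  phrased with it.
\<close>

definition below :: "('a::zero \<Rightarrow> 'g::linorder) \<Rightarrow> 'a \<Rightarrow> 'a \<Rightarrow> bool" where
  "below v x y \<longleftrightarrow> y \<noteq> 0 \<and> (x = 0 \<or> v y < v x)"

locale valued_field =
  fixes w :: "'a::field \<Rightarrow> 'g::linordered_ab_group_add"
  assumes val: "valuation ring_of_type_algebra w"
begin

abbreviation less_val (infix "\<lless>" 50) where "x \<lless> y \<equiv> below w x y"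

text \<open>Equality up to smaller terms: equal value and equal leading coefficient.\<close>

definition close (infix "\<doteq>" 50) where "x \<doteq> y \<longleftrightarrow> x - y \<lless> y"

lemma mult: "x \<noteq> 0 \<Longrightarrow> y \<noteq> 0 \<Longrightarrow> w (x * y) = w x + w y"
  using val_mult[OF val] by simp

lemma add: "x \<noteq> 0 \<Longrightarrow> y \<noteq> 0 \<Longrightarrow> x + y \<noteq> 0 \<Longrightarrow> min (w x) (w y) \<le> w (x + y)"
  using val_add[OF val] by simp

lemma one [simp]: "w 1 = 0"
  using val_one[OF val] by simp

lemma minus [simp]: "w (- x) = w x"
proof (cases "x = 0")
  case False
  have "w (-1) + w (-1) = 0" using mult[of "-1" "-1"] by simp
  then have "w (-1) = 0" by simp
  then show ?thesis using mult[of "-1" x] False by simp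
qed simp

lemma inverse: "x \<noteq> 0 \<Longrightarrow> w (inverse x) = - w x"
  using mult[of x "inverse x"] by (simp add: eq_neg_iff_add_eq_0 add.commute)

lemma divide: "x \<noteq> 0 \<Longrightarrow> y \<noteq> 0 \<Longrightarrow> w (x / y) = w x - w y"
  using mult[of x "inverse y"] inverse[of y] by (simp add: divide_inverse)

lemma below_minus [simp]: "- x \<lless> y \<longleftrightarrow> x \<lless> y" "x \<lless> - y \<longleftrightarrow> x \<lless> y"
  by (auto simp: below_def)

lemma below_diff_commute: "x - y \<lless> z \<longleftrightarrow> y - x \<lless> z"
  using below_minus(1)[of "x - y" z] by simp

lemma below_trans: "x \<lless> y \<Longrightarrow> y \<lless> z \<Longrightarrow> x \<lless> z"
  by (auto simp: below_def)

lemma not_below_trans: "x \<lless> y \<Longrightarrow> \<not> z \<lless> y \<Longrightarrow> x \<lless> z"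
  by (auto simp: below_def)

lemma below_add: "x \<lless> z \<Longrightarrow> y \<lless> z \<Longrightarrow> x + y \<lless> z"
  using add[of x y]
  by (cases "x = 0"; cases "y = 0"; cases "x + y = 0") (auto simp: below_def min_def split: if_splits)

lemma below_diff: "x \<lless> z \<Longrightarrow> y \<lless> z \<Longrightarrow> x - y \<lless> z"
  using below_add[of x z "- y"] by simp

lemma below_mult: "x \<lless> y \<Longrightarrow> z \<noteq> 0 \<Longrightarrow> x * z \<lless> y * z"
  by (cases "x = 0") (auto simp: below_def mult)

lemma close_refl [simp]: "x \<doteq> x \<longleftrightarrow> x \<noteq> 0"
  by (auto simp: close_def below_def)

lemma close_nz: assumes "x \<doteq> y" shows "x \<noteq> 0" "y \<noteq> 0" "w x = w y"
proof -
  show y: "y \<noteq> 0" and "x \<noteq> 0" using assms by (auto simp: close_def below_def)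
  then show "w x = w y"
    using val_add_eq[OF val, of y "x - y"] assms by (auto simp: close_def below_def)
qed

lemma close_below: assumes "x \<doteq> y" shows "z \<lless> x \<longleftrightarrow> z \<lless> y" "x \<lless> z \<longleftrightarrow> y \<lless> z"
  using close_nz[OF assms] by (auto simp: below_def)

lemma close_sym: "x \<doteq> y \<Longrightarrow> y \<doteq> x"
  using close_below(1)[of x y] by (simp add: close_def below_diff_commute)

lemma close_trans: "x \<doteq> y \<Longrightarrow> y \<doteq> z \<Longrightarrow> x \<doteq> z"
  using below_add[of "x - y" z "y - z"] close_below(1)[of y z "x - y"] by (simp add: close_def)

lemma close_mult: assumes "x \<doteq> y" "u \<doteq> v" shows "x * u \<doteq> y * v"
proof -
  have "(x - y) * u \<lless> y * u" "(u - v) * y \<lless> v * y"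
    using assms close_nz[OF assms(1)] close_nz[OF assms(2)] by (auto simp: close_def intro: below_mult)
  moreover have "y * u \<lless> z \<longleftrightarrow> y * v \<lless> z" "z \<lless> y * u \<longleftrightarrow> z \<lless> y * v" for z
    using close_nz[OF assms(1)] close_nz[OF assms(2)] by (auto simp: below_def mult)
  ultimately have "(x - y) * u + (u - v) * y \<lless> y * v"
    by (intro below_add) (auto simp: mult.commute)
  then show ?thesis by (simp add: close_def algebra_simps)
qed

lemma close_inverse: assumes "x \<doteq> y" shows "inverse x \<doteq> inverse y"
proof -
  have nz: "x \<noteq> 0" "y \<noteq> 0" using close_nz[OF assms] by auto
  have "(y - x) * (inverse x * inverse y) \<lless> x * (inverse x * inverse y)"
    using close_sym[OF assms] nz by (intro below_mult) (auto simp: close_def)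
  then show ?thesis using nz by (simp add: close_def field_simps)
qed

lemma close_divide: "x \<doteq> y \<Longrightarrow> u \<doteq> v \<Longrightarrow> x / u \<doteq> y / v"
  unfolding divide_inverse by (intro close_mult close_inverse)

end

text \<open>
  Inclusion of valuation rings means that the values of a coarsening depend monotonically on those of
  the finer valuation.
\<close>

lemma coarsening_le:
  fixes w :: "'a::field \<Rightarrow> 'g::linordered_ab_group_add" and w' :: "'a \<Rightarrow> 'h::linordered_ab_group_add"
  assumes "coarsening ring_of_type_algebra w' w" "x \<noteq> 0" "y \<noteq> 0" "w x \<le> w y"
  shows "w' x \<le> w' y"
proof -
  interpret w: valued_field w using assms(1) by unfold_locales (simp add: coarsening_def)
  interpret w': valued_field w' using assms(1) by unfold_locales (simp add: coarsening_def)
  have "y / x \<in> val_ring ring_of_type_algebra w"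
    using assms by (simp add: val_ring_type w.divide)
  then have "y / x \<in> val_ring ring_of_type_algebra w'"
    using assms(1) by (auto simp: coarsening_def)
  then show ?thesis using assms by (simp add: val_ring_type w'.divide)
qed

lemma coarsening_eq:
  fixes w :: "'a::field \<Rightarrow> 'g::linordered_ab_group_add" and w' :: "'a \<Rightarrow> 'h::linordered_ab_group_add"
  assumes "coarsening ring_of_type_algebra w' w" "x \<noteq> 0" "y \<noteq> 0" "w x = w y"
  shows "w' x = w' y"
  using coarsening_le[OF assms(1-3)] coarsening_le[OF assms(1,3,2)] assms(4) by simp

text \<open>The lexicographic product will be the value group of a composite valuation.\<close>

instance prod :: (linordered_ab_group_add, linordered_ab_group_add) linordered_ab_group_add
  by standard (auto simp: less_eq_prod_def)

section \<open>Polynomials along a nest of balls\<close>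

text \<open>
  A nest of open balls without common point plays the role of a pseudo-convergent sequence without
  pseudo-limit.
\<close>

locale ball_nest = valued_field w for w :: "'a::field \<Rightarrow> 'g::linordered_ab_group_add" +
  fixes C :: "'a set set"
  assumes nonempty: "C \<noteq> {}"
    and chain: "A \<in> C \<Longrightarrow> B \<in> C \<Longrightarrow> A \<subseteq> B \<or> B \<subseteq> A"
    and ball: "B \<in> C \<Longrightarrow> \<exists>c r. r \<noteq> 0 \<and> B = {x. x - c \<lless> r}"
    and no_limit: "\<Inter>C = {}"
begin

text \<open>Holding on some ball of the nest is holding eventually along it.\<close>

definition late :: "('a \<Rightarrow> bool) \<Rightarrow> bool" where "late P \<longleftrightarrow> (\<exists>B\<in>C. \<forall>x\<in>B. P x)"

lemma late_conj: assumes "late P" "late Q" shows "late (\<lambda>x. P x \<and> Q x)"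
proof -
  obtain A B where "A \<in> C" "\<forall>x\<in>A. P x" "B \<in> C" "\<forall>x\<in>B. Q x" using assms by (auto simp: late_def)
  then show ?thesis using chain[of A B] unfolding late_def by blast
qed

lemma late_mono: "late P \<Longrightarrow> (\<And>x. P x \<Longrightarrow> Q x) \<Longrightarrow> late Q"
  by (auto simp: late_def)

lemma late_const: "P \<Longrightarrow> late (\<lambda>_. P)" using nonempty by (auto simp: late_def)

lemma late_ex: assumes "late P" obtains x where "P x"
proof -
  obtain B where B: "B \<in> C" "\<forall>x\<in>B. P x" using assms by (auto simp: late_def)
  obtain c r where "r \<noteq> 0" "B = {x. x - c \<lless> r}" using ball[OF B(1)] by blast
  then have "c \<in> B" by (simp add: below_def)
  then show ?thesis using B(2) that by blast
qed

definition approximant :: "'a poly \<Rightarrow> 'a \<Rightarrow> bool" where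
  "approximant q a \<longleftrightarrow> late (\<lambda>x. poly q x \<doteq> a)"

lemma approximant_nz: "approximant q a \<Longrightarrow> a \<noteq> 0 \<and> q \<noteq> 0"
  by (auto simp: approximant_def elim!: late_ex dest: close_nz)

lemma approximant_unique: assumes "approximant q a" "approximant q b" shows "a \<doteq> b"
proof -
  obtain x where "poly q x \<doteq> a" "poly q x \<doteq> b"
    using late_conj[OF assms[unfolded approximant_def]] by (auto elim: late_ex)
  then show ?thesis using close_sym close_trans by blast
qed

lemma approximant_const: "a \<noteq> 0 \<Longrightarrow> approximant [:a:] a"
  by (auto simp: approximant_def intro: late_const)

lemma approximant_mult:
  assumes "approximant q a" "approximant r b" shows "approximant (q * r) (a * b)"
  unfolding approximant_def
  by (rule late_mono[OF late_conj[OF assms[unfolded approximant_def]]]) (auto intro: close_mult)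

lemma approximant_cancel:
  assumes "approximant (q * r) a" "approximant r b" shows "approximant q (a / b)"
  unfolding approximant_def
proof (rule late_mono[OF late_conj[OF assms[unfolded approximant_def]]])
  fix x assume "poly (q * r) x \<doteq> a \<and> poly r x \<doteq> b"
  then have h: "poly q x * poly r x \<doteq> a" "poly r x \<doteq> b" by auto
  then show "poly q x \<doteq> a / b" using close_divide[OF h] close_nz(1)[OF h(2)] by simp
qed

text \<open>
  This is where it matters that the nest has no common point: a ball that misses \<open>b\<close> is so small that
  the differences of its points from \<open>b\<close> all agree up to smaller terms.
\<close>

lemma approximant_linear: "\<exists>a. approximant [:- b, 1:] a"
proof -
  obtain B where B: "B \<in> C" "b \<notin> B" using no_limit by blast
  obtain c r where c: "r \<noteq> 0" "B = {x. x - c \<lless> r}" using ball[OF B(1)] by blast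
  have nb: "\<not> c - b \<lless> r" using B c by (simp add: below_diff_commute)
  have "poly [:- b, 1:] x \<doteq> c - b" if "x \<in> B" for x
  proof -
    have "x - c \<lless> c - b" using that nb c by (blast intro: not_below_trans)
    then show ?thesis by (simp add: close_def)
  qed
  then show ?thesis using B unfolding approximant_def late_def by blast
qed

text \<open>
  The value \<open>0\<close> stands for the transcendental case, in which all nonzero polynomials have approximants;
  it is convenient because \<open>q mod 0 = q\<close>. Otherwise \<open>p\<close> is going to be a minimal polynomial of a
  common point of the nest in an extension field.
\<close>

definition good_modulus :: "'a poly \<Rightarrow> bool" where
  "good_modulus p \<longleftrightarrow> (p = 0 \<or> (\<nexists>a. approximant p a)) \<and>
     (\<forall>q. q \<noteq> 0 \<longrightarrow> p = 0 \<or> degree q < degree p \<longrightarrow> (\<exists>a. approximant q a))"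

lemma good_modulus_exists: "\<exists>p. good_modulus p"
proof (cases "\<forall>q. q \<noteq> 0 \<longrightarrow> (\<exists>a. approximant q a)")
  case True
  then show ?thesis by (auto simp: good_modulus_def)
next
  case False
  then obtain q0 where q0: "q0 \<noteq> 0 \<and> (\<nexists>a. approximant q0 a)" by blast
  define p where "p = arg_min degree (\<lambda>q. q \<noteq> 0 \<and> (\<nexists>a. approximant q a))"
  have "p \<noteq> 0 \<and> (\<nexists>a. approximant p a)"
    unfolding p_def by (rule arg_min_natI[of _ q0]) (rule q0)
  moreover have "degree p \<le> degree q" if "q \<noteq> 0 \<and> (\<nexists>a. approximant q a)" for q
    unfolding p_def by (rule arg_min_nat_le) (rule that)
  ultimately show ?thesis unfolding good_modulus_def by (metis not_less)
qed

end

locale ball_nest_modulus = ball_nest w C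
  for w :: "'a::field \<Rightarrow> 'g::linordered_ab_group_add" and C +
  fixes p :: "'a poly"
  assumes good: "good_modulus p"
begin

definition lead :: "'a poly \<Rightarrow> 'a \<Rightarrow> bool" where "lead q a \<longleftrightarrow> approximant (q mod p) a"

lemma lead_exists: assumes "\<not> p dvd q" shows "\<exists>a. lead q a"
proof -
  have "q mod p \<noteq> 0" using assms by (simp add: mod_eq_0_iff_dvd)
  moreover have "p = 0 \<or> degree (q mod p) < degree p"
    using degree_mod_less[of p q] \<open>q mod p \<noteq> 0\<close> by auto
  ultimately show ?thesis using good unfolding good_modulus_def lead_def by blast
qed

lemma lead_not_dvd: "lead q a \<Longrightarrow> \<not> p dvd q"
  using approximant_nz by (fastforce simp: lead_def mod_eq_0_iff_dvd)

lemma lead_nz: "lead q a \<Longrightarrow> a \<noteq> 0"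
  using approximant_nz by (auto simp: lead_def)

lemma lead_unique: "lead q a \<Longrightarrow> lead q b \<Longrightarrow> a \<doteq> b"
  unfolding lead_def by (rule approximant_unique)

text \<open>Hence \<open>X\<close> and the constants are their own remainders modulo \<open>p\<close>.\<close>

lemma degree_modulus: "p = 0 \<or> 2 \<le> degree p"
proof (rule ccontr)
  assume "\<not> ?thesis"
  then have p: "p \<noteq> 0" "degree p < 2" by auto
  then have na: "\<nexists>a. approximant p a" using good by (auto simp: good_modulus_def)
  have "p = [:coeff p 0, coeff p 1:]"
    using p by (intro poly_eqI) (auto simp: coeff_pCons coeff_eq_0 split: nat.split)
  then obtain b c where bc: "p = [:b, c:]" by blast
  show False
  proof (cases "c = 0")
    case True
    then show False using na bc approximant_const[of b] p by auto
  next
    case False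
    obtain a where "approximant [:- (- b / c), 1:] a" using approximant_linear by blast
    then have "approximant ([:c:] * [:- (- b / c), 1:]) (c * a)"
      by (intro approximant_mult approximant_const False)
    moreover have "[:c:] * [:- (- b / c), 1:] = p" using False bc by simp
    ultimately show False using na by metis
  qed
qed

lemma lead_small: "degree q < 2 \<Longrightarrow> lead q a \<longleftrightarrow> approximant q a"
  using degree_modulus by (auto simp: lead_def mod_poly_less)

text \<open>
  The heart of Kaplansky's argument. For reduced \<open>Q\<close> and \<open>R\<close> write \<open>Q * R = s * p + t\<close>. If the remainder
  \<open>t\<close> had an approximant different from that of \<open>Q * R\<close>, then \<open>s * p\<close> would have one, namely the
  difference; cancelling the approximant of \<open>s\<close>, which exists because \<open>s\<close> has smaller degree than \<open>p\<close>,
  leaves one for \<open>p\<close>. In particular \<open>p\<close> is prime.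
\<close>

lemma lead_mult: assumes qa: "lead q a" and rb: "lead r b" shows "lead (q * r) (a * b)"
proof -
  define Q R where "Q = q mod p" and "R = r mod p"
  define s t where "s = (Q * R) div p" and "t = (Q * R) mod p"
  have st: "Q * R = s * p + t" by (simp add: s_def t_def)
  have t: "(q * r) mod p = t" by (simp add: t_def Q_def R_def mod_mult_eq)
  have QR: "approximant (Q * R) (a * b)"
    using approximant_mult qa rb by (simp add: lead_def Q_def R_def)
  have QR0: "Q \<noteq> 0" "R \<noteq> 0" using approximant_nz qa rb by (auto simp: lead_def Q_def R_def)
  show ?thesis
  proof (cases "s * p = 0")
    case True
    then show ?thesis using QR st t by (auto simp: lead_def)
  next
    case False
    then have p: "p \<noteq> 0" "s \<noteq> 0" by auto
    have na: "\<not> approximant p e" for e using good p by (auto simp: good_modulus_def)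
    have "degree Q < degree p" "degree R < degree p"
      using degree_mod_less[of p q] degree_mod_less[of p r] p QR0 by (auto simp: Q_def R_def)
    then have "degree (Q * R) < degree p + degree p" using degree_mult_eq[OF QR0] by simp
    moreover have "t = 0 \<or> degree t < degree p"
      unfolding t_def using degree_mod_less[of p "Q * R"] p by auto
    moreover have "s * p = Q * R - t" using st by simp
    then have "degree (s * p) \<le> max (degree (Q * R)) (degree t)" by (metis degree_diff_le_max)
    moreover have "degree (s * p) = degree s + degree p" using p by (simp add: degree_mult_eq)
    ultimately have "degree s < degree p" by (auto simp: max_def split: if_splits)
    then obtain s0 where s0: "approximant s s0" using good p by (auto simp: good_modulus_def)
    have nsp: "\<not> approximant (s * p) e" for e
    proof
      assume "approximant (s * p) e"
      then have "approximant p (e / s0)"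
        using approximant_cancel[of p s e s0] s0 by (simp add: mult.commute)
      then show False using na by blast
    qed
    have "t \<noteq> 0" using nsp QR st by auto
    then obtain d where d: "approximant t d"
      using good \<open>t = 0 \<or> degree t < degree p\<close> by (auto simp: good_modulus_def)
    have "a * b \<doteq> d"
    proof (rule ccontr)
      assume nd: "\<not> a * b \<doteq> d"
      \<comment> \<open>The two approximants do not cancel to leading order, so their difference dominates both.\<close>
      define e where "e = a * b - d"
      have "a * b \<noteq> 0" "d \<noteq> 0" using approximant_nz QR d by blast+
      then have e: "e \<noteq> 0" "\<not> e \<lless> d" using nd by (auto simp: close_def e_def below_def)
      have "\<not> e \<lless> a * b"
      proof
        assume "e \<lless> a * b"
        then have "d \<doteq> a * b" by (simp add: close_def e_def below_diff_commute)
        then show False using nd close_sym by blast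
      qed
      have "approximant (s * p) e"
        unfolding approximant_def
      proof (rule late_mono[OF late_conj[OF QR[unfolded approximant_def] d[unfolded approximant_def]]])
        fix x assume x: "poly (Q * R) x \<doteq> a * b \<and> poly t x \<doteq> d"
        have "poly (Q * R) x - a * b \<lless> e" "poly t x - d \<lless> e"
          using x e(2) \<open>\<not> e \<lless> a * b\<close> not_below_trans unfolding close_def by blast+
        then have "(poly (Q * R) x - a * b) - (poly t x - d) \<lless> e" by (rule below_diff)
        moreover have "poly (s * p) x = poly (Q * R) x - poly t x" using st by simp
        then have "poly (s * p) x - e = (poly (Q * R) x - a * b) - (poly t x - d)"
          by (simp only: e_def) (simp only: algebra_simps)
        ultimately show "poly (s * p) x \<doteq> e" by (simp only: close_def)
      qed
      then show False using nsp by blast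
    qed
    then have "approximant t (a * b)"
      unfolding approximant_def
      by (intro late_mono[OF d[unfolded approximant_def]]) (blast intro: close_trans close_sym)
    then show ?thesis using t by (simp add: lead_def)
  qed
qed

text \<open>
  Inequalities between approximants are obtained by evaluating the polynomials at one late point.
\<close>

lemma lead_combination:
  assumes "lead q b" "lead r c" "lead (q + [:e:] * r) d"
  obtains Q R where "Q \<doteq> b" "R \<doteq> c" "Q + e * R \<doteq> d"
proof -
  have "(q + [:e:] * r) mod p = q mod p + [:e:] * (r mod p)"
    by (simp add: poly_mod_add_left mod_smult_left)
  then have "late (\<lambda>x. poly (q mod p) x \<doteq> b \<and> poly (r mod p) x \<doteq> c \<and>
      poly (q mod p) x + e * poly (r mod p) x \<doteq> d)"
    using assms by (auto simp: lead_def approximant_def intro!: late_conj)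
  then show ?thesis using that by (auto elim: late_ex)
qed

lemma lead_const: "a \<noteq> 0 \<Longrightarrow> lead [:a:] a"
  by (simp add: lead_small approximant_const)

lemma lead_one: "lead 1 1"
  using lead_const[of 1] by (simp add: one_pCons)

end

section \<open>Valuations of the rational function field\<close>

context ball_nest_modulus
begin

text \<open>
  A nonzero fraction is \<open>p ^ m * q / r\<close> with \<open>q\<close> and \<open>r\<close> prime to \<open>p\<close>; the exponent \<open>m\<close> and the quotient
  \<open>a\<close> of the approximants of \<open>q\<close> and \<open>r\<close> together determine the value of the fraction. If \<open>p = 0\<close> there
  is no \<open>p\<close>-adic part, and \<open>m\<close> has to be \<open>0\<close>.
\<close>

definition quotient_lead :: "'a poly fract \<Rightarrow> int \<Rightarrow> 'a \<Rightarrow> bool" where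
  "quotient_lead x m a \<longleftrightarrow> (p = 0 \<longrightarrow> m = 0) \<and>
     (\<exists>q r b c. lead q b \<and> lead r c \<and> a = b / c \<and> x = (Fract p 1) powi m * Fract q r)"


lemma modulus_decomposition:
  assumes "q \<noteq> 0"
  shows "\<exists>j t. q = p ^ j * t \<and> \<not> p dvd t \<and> (p = 0 \<longrightarrow> j = 0)"
proof (cases "p = 0")
  case True
  then show ?thesis using assms by (intro exI[of _ 0] exI[of _ q]) auto
next
  case False
  show ?thesis using assms
  proof (induction "degree q" arbitrary: q rule: less_induct)
    case less
    show ?case
    proof (cases "p dvd q")
      case True
      then obtain s where s: "q = p * s" by blast
      then have "degree s < degree q"
        using less.prems False degree_modulus by (auto simp: degree_mult_eq)
      then obtain j t where "s = p ^ j * t" "\<not> p dvd t" using less s by fastforce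
      then show ?thesis using s False by (intro exI[of _ "Suc j"] exI[of _ t]) (simp add: mult.assoc)
    next
      case ndvd: False
      then show ?thesis using False by (intro exI[of _ 0] exI[of _ q]) simp
    qed
  qed
qed

lemma Fract_power: "Fract q 1 ^ n = Fract (q ^ n) 1"
  by (induction n) (simp_all add: One_fract_def)

lemma lead_nonzero: "lead q a \<Longrightarrow> q \<noteq> 0"
  using lead_not_dvd by auto

lemma quotient_leadI:
  assumes "lead q b" "lead r c" "p = 0 \<longrightarrow> j = 0"
  shows "quotient_lead (Fract (p ^ j * q) r) (int j) (b / c)"
proof -
  have "Fract (p ^ j * q) r = Fract p 1 powi int j * Fract q r"
    by (simp add: Fract_power)
  then show ?thesis unfolding quotient_lead_def using assms by fastforce
qed

lemma quotient_lead_nz: assumes "quotient_lead x m a" shows "a \<noteq> 0" "x \<noteq> 0"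
proof -
  obtain q r b c where h: "lead q b" "lead r c" "a = b / c" "x = (Fract p 1) powi m * Fract q r"
      "p = 0 \<longrightarrow> m = 0"
    using assms by (auto simp: quotient_lead_def)
  have "q \<noteq> 0" "r \<noteq> 0" using h lead_nonzero by auto
  then have "Fract q r \<noteq> 0" "p = 0 \<or> Fract p 1 \<noteq> 0" by (auto simp: Zero_fract_def eq_fract)
  then show "a \<noteq> 0" "x \<noteq> 0" using h lead_nz by auto
qed

lemma quotient_lead_mult:
  assumes "quotient_lead x m a" "quotient_lead y k b"
  shows "quotient_lead (x * y) (m + k) (a * b)"
proof -
  obtain q r c d where x: "lead q c" "lead r d" "a = c / d" "x = (Fract p 1) powi m * Fract q r"
      "p = 0 \<longrightarrow> m = 0"
    using assms(1) by (auto simp: quotient_lead_def)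
  obtain q' r' c' d' where y: "lead q' c'" "lead r' d'" "b = c' / d'"
      "y = (Fract p 1) powi k * Fract q' r'" "p = 0 \<longrightarrow> k = 0"
    using assms(2) by (auto simp: quotient_lead_def)
  have "Fract p 1 powi (m + k) = Fract p 1 powi m * Fract p 1 powi k"
    using x(5) y(5) by (cases "p = 0") (auto simp: Zero_fract_def eq_fract intro!: power_int_add)
  then have "x * y = Fract p 1 powi (m + k) * Fract (q * q') (r * r')"
    using x(4) y(4) by (simp add: mult_ac flip: mult_fract)
  moreover have "a * b = (c * c') / (d * d')" using x y by simp
  moreover have "lead (q * q') (c * c')" "lead (r * r') (d * d')" "p = 0 \<longrightarrow> m + k = 0"
    using x y lead_mult by auto
  ultimately show ?thesis unfolding quotient_lead_def by blast
qed

lemma quotient_lead_inverse: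
  assumes "quotient_lead x m a" shows "quotient_lead (inverse x) (- m) (inverse a)"
proof -
  obtain q r c d where x: "lead q c" "lead r d" "a = c / d" "x = (Fract p 1) powi m * Fract q r"
      "p = 0 \<longrightarrow> m = 0"
    using assms by (auto simp: quotient_lead_def)
  have "inverse x = Fract p 1 powi (- m) * Fract r q" "inverse a = d / c"
    using x by (simp_all add: power_int_minus)
  then show ?thesis unfolding quotient_lead_def using x by (metis neg_equal_0_iff_equal)
qed

text \<open>
  By multiplicativity, uniqueness of the exponent and of the approximant reduces to the fraction \<open>1\<close>.
\<close>

lemma quotient_lead_one:
  assumes "quotient_lead 1 m a" shows "m = 0" "a \<doteq> 1"
proof -
  have *: "m = 0 \<and> a \<doteq> 1" if l: "quotient_lead 1 m a" and m: "0 \<le> m" for m a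
  proof -
    obtain q r b c where x: "lead q b" "lead r c" "a = b / c"
        "1 = (Fract p 1) powi m * Fract q r" "p = 0 \<longrightarrow> m = 0"
      using l by (auto simp: quotient_lead_def)
    have "Fract p 1 powi m = Fract (p ^ nat m) 1"
      using m by (simp add: power_int_def Fract_power)
    then have "Fract 1 1 = Fract (p ^ nat m * q) r" using x(4) by (simp add: One_fract_def)
    then have eq: "r = p ^ nat m * q" using lead_nonzero x by (simp add: eq_fract)
    have "nat m = 0"
    proof (rule ccontr)
      assume "nat m \<noteq> 0"
      then have "p dvd r" unfolding eq by (intro dvd_mult2 dvd_power) auto
      then show False using lead_not_dvd x by blast
    qed
    then have "m = 0" "q = r" using m eq by auto
    then have "b / c \<doteq> c / c" using x lead_unique lead_nz by (intro close_divide) auto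
    then show ?thesis using \<open>m = 0\<close> x lead_nz by simp
  qed
  show "m = 0" "a \<doteq> 1"
    using *[OF assms] *[of "- m" "inverse a"] quotient_lead_inverse[OF assms]
      close_inverse[of "inverse a" 1] by (cases "0 \<le> m"; simp)+
qed

lemma quotient_lead_unique:
  assumes "quotient_lead x m a" "quotient_lead x k b" shows "m = k" "a \<doteq> b"
proof -
  have "quotient_lead (x * inverse x) (m + - k) (a * inverse b)"
    by (intro quotient_lead_mult quotient_lead_inverse assms)
  then have "quotient_lead 1 (m - k) (a / b)"
    using quotient_lead_nz[OF assms(1)] by (simp add: divide_inverse)
  then have "m - k = 0" "a / b \<doteq> 1" by (rule quotient_lead_one)+
  then have "a / b * b \<doteq> 1 * b" using quotient_lead_nz[OF assms(2)] by (intro close_mult) auto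
  then show "m = k" "a \<doteq> b"
    using \<open>m - k = 0\<close> quotient_lead_nz[OF assms(2)] by simp_all
qed

lemma quotient_lead_exists: assumes "x \<noteq> 0" shows "\<exists>m a. quotient_lead x m a"
proof -
  have poly: "\<exists>m a. quotient_lead (Fract q 1) m a" if q: "q \<noteq> 0" for q
  proof -
    obtain j t where t: "q = p ^ j * t" "\<not> p dvd t" "p = 0 \<longrightarrow> j = 0"
      using modulus_decomposition[OF q] by blast
    obtain d where "lead t d" using lead_exists t by blast
    then show ?thesis using quotient_leadI[OF _ lead_one t(3)] t(1) by blast
  qed
  obtain q r where x: "x = Fract q r" "r \<noteq> 0" "q \<noteq> 0"
    using assms by (cases x rule: Fract_cases_nonzero) blast+
  obtain m a k b where "quotient_lead (Fract q 1) m a" "quotient_lead (Fract r 1) k b"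
    using poly x by blast
  then have "quotient_lead (Fract q 1 * inverse (Fract r 1)) (m + - k) (a * inverse b)"
    by (intro quotient_lead_mult quotient_lead_inverse)
  moreover have "Fract q 1 * inverse (Fract r 1) = x" using x by simp
  ultimately show ?thesis by metis
qed

text \<open>
  For a coarsening \<open>\<sigma>\<close> of \<open>w\<close> this is the composite of the \<open>p\<close>-adic valuation with the extension of
  \<open>\<sigma>\<close> to \<open>K[X]/(p)\<close> or, if \<open>p = 0\<close>, just the extension of \<open>\<sigma>\<close> to \<open>K(X)\<close>. It will be used for
  \<open>\<sigma> = w\<close> and for \<open>\<sigma> = w'\<close>.
\<close>

definition fract_val :: "('a \<Rightarrow> 'h) \<Rightarrow> 'a poly fract \<Rightarrow> int \<times> 'h" where
  "fract_val \<sigma> x = (SOME v. \<exists>m a. quotient_lead x m a \<and> v = (m, \<sigma> a))"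

context
  fixes \<sigma> :: "'a \<Rightarrow> 'h::linordered_ab_group_add"
  assumes coarse: "coarsening ring_of_type_algebra \<sigma> w"
begin

interpretation \<sigma>: valued_field \<sigma> using coarse by unfold_locales (simp add: coarsening_def)

lemma close_coarse: "a \<doteq> b \<Longrightarrow> \<sigma> a = \<sigma> b"
  using coarsening_eq[OF coarse] close_nz by blast

lemma fract_val_eq: assumes "quotient_lead x m a" shows "fract_val \<sigma> x = (m, \<sigma> a)"
  unfolding fract_val_def
proof (rule some_equality)
  fix v assume "\<exists>m a. quotient_lead x m a \<and> v = (m, \<sigma> a)"
  then obtain k b where "quotient_lead x k b" "v = (k, \<sigma> b)" by blast
  then show "v = (m, \<sigma> a)"
    using quotient_lead_unique[OF _ assms, of k b] close_coarse by simp
next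
  show "\<exists>k b. quotient_lead x k b \<and> (m, \<sigma> a) = (k, \<sigma> b)"
    by (intro exI conjI) (rule assms, rule refl)
qed

lemma fract_val_valuation: "valuation ring_of_type_algebra (fract_val \<sigma>)"
proof (rule valuation_typeI)
  fix x y :: "'a poly fract" assume "x \<noteq> 0" "y \<noteq> 0"
  then obtain m a k b where xy: "quotient_lead x m a" "quotient_lead y k b"
    using quotient_lead_exists by blast
  then show "fract_val \<sigma> (x * y) = fract_val \<sigma> x + fract_val \<sigma> y"
    using fract_val_eq[OF quotient_lead_mult[OF xy]] quotient_lead_nz[OF xy(1)] quotient_lead_nz[OF xy(2)]
    by (simp add: fract_val_eq[OF xy(1)] fract_val_eq[OF xy(2)] \<sigma>.mult)
next
  fix z :: "'a poly fract" assume z: "z \<noteq> 0" "1 + z \<noteq> 0" "0 \<le> fract_val \<sigma> z"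
  obtain m a where ma: "quotient_lead z m a" using quotient_lead_exists z by blast
  obtain q r b c where x: "lead q b" "lead r c" "a = b / c" "z = (Fract p 1) powi m * Fract q r"
      "p = 0 \<longrightarrow> m = 0"
    using ma by (auto simp: quotient_lead_def)
  have nz: "b \<noteq> 0" "c \<noteq> 0" "r \<noteq> 0" using lead_nz lead_nonzero x by auto
  have m: "0 \<le> m" "m = 0 \<Longrightarrow> \<sigma> c \<le> \<sigma> b"
    using z fract_val_eq[OF ma] nz x by (auto simp: less_eq_prod_def zero_prod_def \<sigma>.divide)
  define s where "s = r + p ^ nat m * q"
  have "Fract p 1 powi m = Fract (p ^ nat m) 1"
    using m by (simp add: power_int_def Fract_power)
  then have eq: "1 + z = Fract s r" using x nz by (simp add: One_fract_def s_def)
  then have "s \<noteq> 0" using z by (auto simp: Zero_fract_def eq_fract nz)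
  then obtain j t where t: "s = p ^ j * t" "\<not> p dvd t" "p = 0 \<longrightarrow> j = 0"
    using modulus_decomposition by blast
  obtain d where d: "lead t d" using lead_exists t by blast
  have l: "fract_val \<sigma> (1 + z) = (int j, \<sigma> (d / c))"
    using fract_val_eq[OF quotient_leadI[OF d x(2) t(3)]] eq t by simp
  \<comment> \<open>If \<open>m > 0\<close> then \<open>s\<close> and \<open>r\<close> agree modulo \<open>p\<close>; if \<open>m = 0\<close> then \<open>s = r + q\<close> is evaluated at a late point.\<close>
  have "\<sigma> c \<le> \<sigma> d" if "j = 0"
  proof (cases "m = 0")
    case True
    then have "lead (r + [:1:] * q) d" using d t that by (simp add: s_def)
    then obtain R Q where "R \<doteq> c" "Q \<doteq> b" "R + 1 * Q \<doteq> d"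
      using lead_combination[OF x(2,1)] by blast
    then show ?thesis
      using \<sigma>.add[of R Q] m(2)[OF True] close_coarse close_nz by (metis min.absorb1 mult_1)
  next
    case False
    then have "s mod p = r mod p" using m by (simp add: s_def mod_eq_dvd_iff)
    then have "lead r d" using d t that by (simp add: lead_def)
    then show ?thesis using lead_unique x(2) close_coarse by fastforce
  qed
  then show "0 \<le> fract_val \<sigma> (1 + z)"
    unfolding l using lead_nz[OF d] nz by (auto simp: less_eq_prod_def zero_prod_def \<sigma>.divide)
qed


end

definition const_fract :: "'a \<Rightarrow> 'a poly fract" where "const_fract a = Fract [:a:] 1"

lemma const_fract_hom: "const_fract (a + b) = const_fract a + const_fract b" "const_fract (a * b) = const_fract a * const_fract b"
  "const_fract 1 = 1" "const_fract 0 = 0"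
  by (simp_all add: const_fract_def One_fract_def Zero_fract_def one_pCons mult.commute)

lemma quotient_lead_const: "a \<noteq> 0 \<Longrightarrow> quotient_lead (const_fract a) 0 a"
  using quotient_leadI[OF lead_const lead_one, of a 0] by (simp add: const_fract_def)

lemma fract_val_const:
  "coarsening ring_of_type_algebra \<sigma> w \<Longrightarrow> a \<noteq> 0 \<Longrightarrow> fract_val \<sigma> (const_fract a) = (0, \<sigma> a)"
  by (intro fract_val_eq quotient_lead_const)

lemma coarsening_self: "coarsening ring_of_type_algebra w w"
  using val by (simp add: coarsening_def)

lemma fract_val_coarsening:
  fixes \<sigma> :: "'a \<Rightarrow> 'h::linordered_ab_group_add"
  assumes coarse: "coarsening ring_of_type_algebra \<sigma> w"
  shows "coarsening ring_of_type_algebra (fract_val \<sigma>) (fract_val w)"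
proof -
  interpret \<sigma>: valued_field \<sigma> using coarse by unfold_locales (simp add: coarsening_def)
  have "0 \<le> fract_val \<sigma> x" if x: "0 \<le> fract_val w x" "x \<noteq> 0" for x
  proof -
    obtain m a where ma: "quotient_lead x m a" using quotient_lead_exists x by blast
    show ?thesis
      using x coarsening_le[OF coarse, of 1 a] quotient_lead_nz[OF ma]
      by (auto simp: fract_val_eq[OF coarse ma] fract_val_eq[OF coarsening_self ma] less_eq_prod_def zero_prod_def)
  qed
  then show ?thesis
    using fract_val_valuation[OF coarse] fract_val_valuation[OF coarsening_self]
    by (auto simp: coarsening_def val_ring_type)
qed

text \<open>
  The approximant of a unit agrees with it up to terms of higher value: \<open>q - a * r\<close> is small because
  \<open>q\<close> and \<open>a * r\<close> have the same approximant. This will make the extension of residue fields immediate.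
\<close>

lemma fract_val_immediate:
  fixes \<sigma> :: "'a \<Rightarrow> 'h::linordered_ab_group_add"
  assumes coarse: "coarsening ring_of_type_algebra \<sigma> w" and x: "x \<noteq> 0" "fract_val \<sigma> x = 0"
  shows "\<exists>a. below (fract_val w) (x - const_fract a) x"
proof -
  obtain m a where ma: "quotient_lead x m a" using quotient_lead_exists x by blast
  then have m: "m = 0" using x fract_val_eq[OF coarse ma] by (simp add: zero_prod_def)
  obtain q r b c where h: "lead q b" "lead r c" "a = b / c" "x = Fract q r"
    using ma m by (auto simp: quotient_lead_def)
  have nz: "b \<noteq> 0" "c \<noteq> 0" "r \<noteq> 0" using lead_nz lead_nonzero h by auto
  define s where "s = q + [:- a:] * r"
  have eq: "x - const_fract a = Fract s r" using h nz by (simp add: const_fract_def s_def)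
  have "below (fract_val w) (x - const_fract a) x"
  proof (cases "s = 0")
    case True
    then show ?thesis using eq x nz by (simp add: below_def Zero_fract_def eq_fract)
  next
    case False
    then obtain j t where t: "s = p ^ j * t" "\<not> p dvd t" "p = 0 \<longrightarrow> j = 0"
      using modulus_decomposition by blast
    obtain d where d: "lead t d" using lead_exists t by blast
    have l: "fract_val w (x - const_fract a) = (int j, w (d / c))"
      using fract_val_eq[OF coarsening_self quotient_leadI[OF d h(2) t(3)]] eq t by simp
    have "d \<lless> b" if "j = 0"
    proof -
      have "lead (q + [:- a:] * r) d" using d t that by (simp add: s_def)
      then obtain Q R where QR: "Q \<doteq> b" "R \<doteq> c" "Q + - a * R \<doteq> d"
        using lead_combination[OF h(1,2)] by blast
      have "a \<noteq> 0" using h nz by simp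
      then have "a * R \<doteq> a * c" using QR by (intro close_mult) auto
      moreover have "a * c = b" using h nz by simp
      ultimately have "Q - b \<lless> b" "a * R - b \<lless> b" using QR(1) by (auto simp: close_def)
      then have "(Q - b) - (a * R - b) \<lless> b" by (rule below_diff)
      then have "Q + - a * R \<lless> b" by simp
      then show ?thesis using close_below(2)[OF QR(3)] by blast
    qed
    then show ?thesis
      using l fract_val_eq[OF coarsening_self ma] x h nz m lead_nz[OF d]
      by (auto simp: below_def divide less_prod_def')
  qed
  then show ?thesis by blast
qed

definition indeterminate :: "'a poly fract" where "indeterminate = Fract [:0, 1:] 1"

lemma indeterminate_const: "indeterminate - const_fract b = Fract [:- b, 1:] 1"
  by (simp add: indeterminate_def const_fract_def)

lemma quotient_lead_linear:
  obtains d where "quotient_lead (indeterminate - const_fract b) 0 d" "late (\<lambda>x. x - b \<doteq> d)"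
proof -
  obtain d where d: "approximant [:- b, 1:] d" using approximant_linear by blast
  then have "lead [:- b, 1:] d" by (simp add: lead_small)
  then have "quotient_lead (indeterminate - const_fract b) 0 d"
    using quotient_leadI[OF _ lead_one, of "[:- b, 1:]" d 0] by (simp add: indeterminate_const)
  then show ?thesis using d that by (simp add: approximant_def)
qed

end

section \<open>Immediate extensions of residue fields\<close>

text \<open>
  Equality of value groups and of residue fields both follow from one condition: each nonzero element
  of the extension agrees with an element of the base up to terms of higher value.
\<close>

lemma immediate_extensionI:
  assumes ext: "valued_extension F v L u h"
    and approx: "\<And>x. x \<in> carrier L \<Longrightarrow> x \<noteq> \<zero>\<^bsub>L\<^esub> \<Longrightarrow>
      \<exists>a\<in>carrier F. x \<ominus>\<^bsub>L\<^esub> h a = \<zero>\<^bsub>L\<^esub> \<or> u x < u (x \<ominus>\<^bsub>L\<^esub> h a)"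
  shows "immediate_extension F v L u h"
proof -
  have v: "valuation F v" and u: "valuation L u" and h: "h \<in> ring_hom F L"
    and uh: "\<And>x. x \<in> carrier F \<Longrightarrow> x \<noteq> \<zero>\<^bsub>F\<^esub> \<Longrightarrow> u (h x) = v x"
    using ext by (auto simp: valued_extension_def)
  interpret F: field F using v by (simp add: valuation_def)
  interpret L: field L using u by (simp add: valuation_def)
  interpret h: ring_hom_cring F L h
    using h by (intro ring_hom_cring.intro ring_hom_cring_axioms.intro F.is_cring L.is_cring)
  have hnz: "h a \<noteq> \<zero>\<^bsub>L\<^esub>" if "a \<in> carrier F" "a \<noteq> \<zero>\<^bsub>F\<^esub>" for a
    using that ring_hom_cring.axioms F.field_Units
    by (metis Diff_iff L.zero_not_one F.Units_r_inv F.Units_inv_closed L.l_null h.hom_mult h.hom_one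
        h.hom_closed singletonD insert_Diff_single insertE)
  have app: "\<exists>a\<in>carrier F. a \<noteq> \<zero>\<^bsub>F\<^esub> \<and> u x = v a \<and> (x \<ominus>\<^bsub>L\<^esub> h a = \<zero>\<^bsub>L\<^esub> \<or> u x < u (x \<ominus>\<^bsub>L\<^esub> h a))"
    if x: "x \<in> carrier L" "x \<noteq> \<zero>\<^bsub>L\<^esub>" for x
  proof -
    obtain a where a: "a \<in> carrier F" "x \<ominus>\<^bsub>L\<^esub> h a = \<zero>\<^bsub>L\<^esub> \<or> u x < u (x \<ominus>\<^bsub>L\<^esub> h a)"
      using approx[OF x] by blast
    have nz: "a \<noteq> \<zero>\<^bsub>F\<^esub>"
    proof
      assume "a = \<zero>\<^bsub>F\<^esub>"
      then have "x \<ominus>\<^bsub>L\<^esub> h a = x" using x by (simp add: a_minus_def)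
      then show False using a x by simp
    qed
    define y where "y = x \<ominus>\<^bsub>L\<^esub> h a"
    have y: "y \<in> carrier L" using x a by (simp add: y_def)
    have ha: "h a = x \<oplus>\<^bsub>L\<^esub> (\<ominus>\<^bsub>L\<^esub> y)"
      using x a by (simp add: y_def a_minus_def L.minus_add L.r_neg2)
    have "\<ominus>\<^bsub>L\<^esub> y = \<zero>\<^bsub>L\<^esub> \<or> u x < u (\<ominus>\<^bsub>L\<^esub> y)"
      using a(2) val_minus[OF u y] L.minus_zero by (cases "y = \<zero>\<^bsub>L\<^esub>") (auto simp: y_def)
    then have "u (h a) = u x"
      unfolding ha using val_add_eq[OF u x(1) _ x(2)] y by simp
    then show ?thesis using a nz uh by auto
  qed
  have "value_group L u = value_group F v"
  proof (intro subset_antisym subsetI)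
    fix g assume "g \<in> value_group L u"
    then show "g \<in> value_group F v" using app by (fastforce simp: value_group_def)
  next
    fix g assume "g \<in> value_group F v"
    then obtain a where "a \<in> carrier F" "a \<noteq> \<zero>\<^bsub>F\<^esub>" "g = u (h a)"
      using uh by (auto simp: value_group_def)
    then show "g \<in> value_group L u" using hnz by (auto simp: value_group_def)
  qed
  moreover have "carrier (residue_field L u) = (\<lambda>a. residue L u (h a)) ` val_ring F v"
  proof (unfold residue_field_simps(1)[OF u], intro subset_antisym subsetI)
    fix C assume "C \<in> residue L u ` val_ring L u"
    then obtain x where x: "x \<in> val_ring L u" "C = residue L u x" by blast
    have xc: "x \<in> carrier L" using x by (simp add: val_ring_def)
    show "C \<in> (\<lambda>a. residue L u (h a)) ` val_ring F v"
    proof (cases "x = \<zero>\<^bsub>L\<^esub>")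
      case True
      then show ?thesis using x by (intro image_eqI[of _ _ "\<zero>\<^bsub>F\<^esub>"]) (auto simp: val_ring_def)
    next
      case False
      then obtain a where a: "a \<in> carrier F" "a \<noteq> \<zero>\<^bsub>F\<^esub>" "u x = v a"
          "x \<ominus>\<^bsub>L\<^esub> h a = \<zero>\<^bsub>L\<^esub> \<or> u x < u (x \<ominus>\<^bsub>L\<^esub> h a)"
        using app xc by blast
      have "0 \<le> u x" using x False by (simp add: val_ring_def)
      then have "a \<in> val_ring F v" "h a \<in> val_ring L u" "x \<ominus>\<^bsub>L\<^esub> h a \<in> val_ideal L u"
        using a xc uh[of a] by (auto simp: val_ring_def val_ideal_def)
      then show ?thesis using x residue_eq_iff[OF u x(1), of "h a"] by blast
    qed
  next
    fix C assume "C \<in> (\<lambda>a. residue L u (h a)) ` val_ring F v"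
    then obtain a where a: "a \<in> val_ring F v" "C = residue L u (h a)" by blast
    have "h a \<in> val_ring L u"
      using a uh[of a] by (cases "a = \<zero>\<^bsub>F\<^esub>") (auto simp: val_ring_def)
    then show "C \<in> residue L u ` val_ring L u" using a by blast
  qed
  ultimately show ?thesis using ext by (simp add: immediate_extension_def)
qed

text \<open>
  Transport along an injection \<open>j\<close> moves an extension into the type over which maximality quantifies.
\<close>

lemma immediate_extension_image:
  fixes F :: "('b, 'm) ring_scheme" and L :: "('c, 'n) ring_scheme" and j :: "'c \<Rightarrow> 'd"
  assumes ext: "valued_extension F v L u h"
    and approx: "\<And>x. x \<in> carrier L \<Longrightarrow> x \<noteq> \<zero>\<^bsub>L\<^esub> \<Longrightarrow>
      \<exists>a\<in>carrier F. x \<ominus>\<^bsub>L\<^esub> h a = \<zero>\<^bsub>L\<^esub> \<or> u x < u (x \<ominus>\<^bsub>L\<^esub> h a)"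
    and j: "inj_on j (carrier L)"
  shows "immediate_extension F v (image_ring j L) (u \<circ> inv_into (carrier L) j) (j \<circ> h)"
proof -
  have v: "valuation F v" and u: "valuation L u" and h: "h \<in> ring_hom F L"
    and uh: "\<And>x. x \<in> carrier F \<Longrightarrow> x \<noteq> \<zero>\<^bsub>F\<^esub> \<Longrightarrow> u (h x) = v x"
    using ext by (auto simp: valued_extension_def)
  interpret F: field F using v by (simp add: valuation_def)
  interpret L: field L using u by (simp add: valuation_def)
  have hc: "h a \<in> carrier L" if "a \<in> carrier F" for a using ring_hom_closed[OF h that] .
  define M where "M = image_ring j L"
  define k where "k = inv_into (carrier L) j"
  interpret M: field M unfolding M_def using L.inj_imp_image_ring_is_field[OF j] by simp
  have iso: "j \<in> ring_iso L M" unfolding M_def by (rule inj_imp_image_ring_iso[OF j])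
  then have jh: "j \<in> ring_hom L M" by (simp add: ring_iso_def)
  interpret j: ring_hom_cring L M j
    using jh by (intro ring_hom_cring.intro ring_hom_cring_axioms.intro L.is_cring M.is_cring)
  have kj: "k (j x) = x" if "x \<in> carrier L" for x using j that by (simp add: k_def)
  have Mc: "carrier M = j ` carrier L" by (simp add: M_def image_ring_carrier)
  have jz: "j x = \<zero>\<^bsub>M\<^esub> \<longleftrightarrow> x = \<zero>\<^bsub>L\<^esub>" if "x \<in> carrier L" for x
    using kj[OF that] kj[of "\<zero>\<^bsub>L\<^esub>"] by auto
  have jm: "j x \<ominus>\<^bsub>M\<^esub> j y = j (x \<ominus>\<^bsub>L\<^esub> y)" if "x \<in> carrier L" "y \<in> carrier L" for x y
    using that by (simp add: a_minus_def)
  have "valuation M (u \<circ> k)"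
    unfolding valuation_def
  proof (intro conjI ballI impI)
    fix S T assume "S \<in> carrier M - {\<zero>\<^bsub>M\<^esub>}" "T \<in> carrier M - {\<zero>\<^bsub>M\<^esub>}"
    then obtain x y where xy: "x \<in> carrier L" "x \<noteq> \<zero>\<^bsub>L\<^esub>" "S = j x" "y \<in> carrier L" "y \<noteq> \<zero>\<^bsub>L\<^esub>" "T = j y"
      by (auto simp: Mc jz)
    then show "(u \<circ> k) (S \<otimes>\<^bsub>M\<^esub> T) = (u \<circ> k) S + (u \<circ> k) T"
      by (simp add: kj val_mult[OF u] flip: j.hom_mult)
    assume "S \<oplus>\<^bsub>M\<^esub> T \<noteq> \<zero>\<^bsub>M\<^esub>"
    then have "x \<oplus>\<^bsub>L\<^esub> y \<noteq> \<zero>\<^bsub>L\<^esub>" using xy by (auto simp flip: j.hom_add)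
    then have "min (u x) (u y) \<le> u (x \<oplus>\<^bsub>L\<^esub> y)" using xy val_add[OF u] by blast
    then show "min ((u \<circ> k) S) ((u \<circ> k) T) \<le> (u \<circ> k) (S \<oplus>\<^bsub>M\<^esub> T)"
      using xy by (simp add: kj flip: j.hom_add)
  qed (rule M.field_axioms)
  moreover have "j \<circ> h \<in> ring_hom F M" using ring_hom_trans[OF h jh] .
  ultimately have ext': "valued_extension F v M (u \<circ> k) (j \<circ> h)"
    using v uh hc by (auto simp: valued_extension_def kj)
  have "immediate_extension F v M (u \<circ> k) (j \<circ> h)"
  proof (rule immediate_extensionI[OF ext'])
    fix y assume "y \<in> carrier M" "y \<noteq> \<zero>\<^bsub>M\<^esub>"
    then obtain x where x: "x \<in> carrier L" "y = j x" "x \<noteq> \<zero>\<^bsub>L\<^esub>" using jz by (auto simp: Mc)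
    then obtain a where a: "a \<in> carrier F" "x \<ominus>\<^bsub>L\<^esub> h a = \<zero>\<^bsub>L\<^esub> \<or> u x < u (x \<ominus>\<^bsub>L\<^esub> h a)"
      using approx by blast
    have d: "x \<ominus>\<^bsub>L\<^esub> h a \<in> carrier L" using x(1) hc[OF a(1)] by simp
    have "y \<ominus>\<^bsub>M\<^esub> (j \<circ> h) a = j (x \<ominus>\<^bsub>L\<^esub> h a)" 
      unfolding x(2) comp_apply by (rule jm[OF x(1) hc[OF a(1)]])
    then have "y \<ominus>\<^bsub>M\<^esub> (j \<circ> h) a = \<zero>\<^bsub>M\<^esub> \<or> (u \<circ> k) y < (u \<circ> k) (y \<ominus>\<^bsub>M\<^esub> (j \<circ> h) a)"
      using a(2) x(2) kj[OF d] kj[OF x(1)] jz[OF d] by auto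
    then show "\<exists>a\<in>carrier F. y \<ominus>\<^bsub>M\<^esub> (j \<circ> h) a = \<zero>\<^bsub>M\<^esub> \<or> (u \<circ> k) y < (u \<circ> k) (y \<ominus>\<^bsub>M\<^esub> (j \<circ> h) a)"
      using a(1) by blast
  qed
  then show ?thesis by (simp add: M_def k_def)
qed

lemma maximal_valued_field_surj:
  fixes F :: "('b, 'm) ring_scheme" and L :: "('c, 'n) ring_scheme" and j :: "'c \<Rightarrow> 'b set"
  assumes maximal: "maximal_valued_field F v"
    and ext: "valued_extension F v L u h"
    and approx: "\<And>x. x \<in> carrier L \<Longrightarrow> x \<noteq> \<zero>\<^bsub>L\<^esub> \<Longrightarrow>
      \<exists>a\<in>carrier F. x \<ominus>\<^bsub>L\<^esub> h a = \<zero>\<^bsub>L\<^esub> \<or> u x < u (x \<ominus>\<^bsub>L\<^esub> h a)"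
    and j: "inj_on j (carrier L)"
  shows "h ` carrier F = carrier L"
proof -
  have "(j \<circ> h) ` carrier F = carrier (image_ring j L)"
    using maximal immediate_extension_image[OF ext approx j] unfolding maximal_valued_field_def by blast
  then have "j ` h ` carrier F = j ` carrier L" by (simp add: image_ring_carrier image_comp)
  moreover have "h ` carrier F \<subseteq> carrier L"
    using ext ring_hom_closed by (fastforce simp: valued_extension_def)
  ultimately show ?thesis by (simp add: inj_on_image_eq_iff[OF j])
qed

lemma residue_minus:
  assumes v: "valuation F v" and a: "a \<in> val_ring F v" "b \<in> val_ring F v"
  shows "residue F v a \<ominus>\<^bsub>residue_field F v\<^esub> residue F v b = residue F v (a \<ominus>\<^bsub>F\<^esub> b)"
proof -
  interpret F: field F using v by (simp add: valuation_def)
  interpret Q: field "residue_field F v" by (rule residue_field_field[OF v])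
  have ab: "a \<ominus>\<^bsub>F\<^esub> b \<in> val_ring F v" "a \<in> carrier F" "b \<in> carrier F"
    using a subringE(5,7)[OF val_ring_subring[OF v]] by (auto simp: a_minus_def val_ring_def)
  have c: "residue F v x \<in> carrier (residue_field F v)" if "x \<in> val_ring F v" for x
    using that by (simp add: residue_field_simps(1)[OF v])
  have "residue F v a = residue F v (a \<ominus>\<^bsub>F\<^esub> b) \<oplus>\<^bsub>residue_field F v\<^esub> residue F v b"
    using ab a by (simp add: residue_field_simps(5)[OF v] a_minus_def F.a_assoc F.l_neg)
  then show ?thesis
    using c[OF ab(1)] c[OF a(2)] by (simp add: a_minus_def Q.a_assoc Q.r_neg)
qed

text \<open>
  Let \<open>\<kappa>\<close> embed \<open>K\<close> with valuations \<open>w\<close> and \<open>w'\<close> into \<open>E\<close> with valuations \<open>W\<close> and \<open>V\<close>. If the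
  \<open>V\<close>-units of \<open>E\<close> agree with elements of \<open>K\<close> up to \<open>W\<close>-smaller terms, then \<open>EV\<close> with the valuation induced
  by \<open>W\<close> extends \<open>Kw'\<close> immediately. The valuation on \<open>EV\<close> must take its values where \<open>wb\<close> does, although
  \<open>wb\<close> and \<open>W\<close> are unrelated as functions. So the value of the residue of \<open>x\<close> is defined as that of the
  residue of an element of \<open>K\<close> having the same \<open>W\<close>-value as \<open>x\<close>; it does not depend on choices because
  \<open>wb\<close> orders the residues of \<open>w'\<close>-units in the same way as \<open>w\<close> orders the units.
\<close>

lemma residue_extension:
  fixes w :: "'a::field \<Rightarrow> 'g::linordered_ab_group_add" and w' :: "'a \<Rightarrow> 'h::linordered_ab_group_add"
    and W :: "'e::field \<Rightarrow> 'v::linordered_ab_group_add" and V :: "'e \<Rightarrow> 'u::linordered_ab_group_add"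
    and wb :: "'a set \<Rightarrow> 'k::linordered_ab_group_add" and \<kappa> :: "'a \<Rightarrow> 'e"
  assumes coarse: "coarsening ring_of_type_algebra w' w" "coarsening ring_of_type_algebra V W"
    and wb: "induced_valuation ring_of_type_algebra w w' wb"
    and hom: "\<And>a b. \<kappa> (a + b) = \<kappa> a + \<kappa> b" "\<And>a b. \<kappa> (a * b) = \<kappa> a * \<kappa> b" "\<kappa> 1 = 1"
    and W: "\<And>a b. a \<noteq> 0 \<Longrightarrow> b \<noteq> 0 \<Longrightarrow> W (\<kappa> a) \<le> W (\<kappa> b) \<longleftrightarrow> w a \<le> w b"
    and V: "\<And>a. a \<noteq> 0 \<Longrightarrow> 0 \<le> V (\<kappa> a) \<longleftrightarrow> 0 \<le> w' a" "\<And>a. a \<noteq> 0 \<Longrightarrow> 0 < V (\<kappa> a) \<longleftrightarrow> 0 < w' a"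
    and approx: "\<And>x. x \<noteq> 0 \<Longrightarrow> V x = 0 \<Longrightarrow> \<exists>a. below W (x - \<kappa> a) x"
  shows "\<exists>u h. valued_extension (residue_field ring_of_type_algebra w') wb
        (residue_field ring_of_type_algebra V) u h \<and>
      (\<forall>a\<in>val_ring ring_of_type_algebra w'.
        h (residue ring_of_type_algebra w' a) = residue ring_of_type_algebra V (\<kappa> a)) \<and>
      (\<forall>S\<in>carrier (residue_field ring_of_type_algebra V).
        S \<noteq> \<zero>\<^bsub>residue_field ring_of_type_algebra V\<^esub> \<longrightarrow>
        (\<exists>A\<in>carrier (residue_field ring_of_type_algebra w').
          S \<ominus>\<^bsub>residue_field ring_of_type_algebra V\<^esub> h A = \<zero>\<^bsub>residue_field ring_of_type_algebra V\<^esub> \<or>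
          u S < u (S \<ominus>\<^bsub>residue_field ring_of_type_algebra V\<^esub> h A)))"
proof -
  define K where "K = (ring_of_type_algebra :: 'a ring)"
  define E where "E = (ring_of_type_algebra :: 'e ring)"
  define k where "k = residue_field K w'"
  define l where "l = residue_field E V"
  define res where "res = residue K w'"
  define Res where "Res = residue E V"
  have vals: "valuation K w'" "valuation E V" "valuation K w" "valuation E W"
    using coarse by (auto simp: coarsening_def K_def E_def)
  interpret w: valued_field w using vals by unfold_locales (simp add: K_def)
  interpret w': valued_field w' using vals by unfold_locales (simp add: K_def)
  interpret W: valued_field W using vals by unfold_locales (simp add: E_def)
  interpret V: valued_field V using vals by unfold_locales (simp add: E_def)
  interpret k: field k unfolding k_def by (rule residue_field_field[OF vals(1)])
  interpret l: field l unfolding l_def by (rule residue_field_field[OF vals(2)])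
  note ks = residue_field_simps[OF vals(1), folded k_def res_def]
  note ls = residue_field_simps[OF vals(2), folded l_def Res_def]
  have \<kappa>0: "\<kappa> 0 = 0" using hom(1)[of 0 0] by (simp only: add_0 add_cancel_right_right)
  have \<kappa>m: "\<kappa> (a - b) = \<kappa> a - \<kappa> b" for a b
    using hom(1)[of "a - b" b] by simp
  have \<kappa>nz: "\<kappa> a \<noteq> 0" if "a \<noteq> 0" for a
    using hom(2)[of a "inverse a"] that hom(3) by auto
  have Rk: "a \<in> val_ring K w' \<longleftrightarrow> a = 0 \<or> 0 \<le> w' a" for a by (simp add: K_def val_ring_type)
  have Ik: "a \<in> val_ideal K w' \<longleftrightarrow> a = 0 \<or> 0 < w' a" for a by (simp add: K_def val_ideal_type)
  have Rl: "x \<in> val_ring E V \<longleftrightarrow> x = 0 \<or> 0 \<le> V x" for x by (simp add: E_def val_ring_type)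
  have Il: "x \<in> val_ideal E V \<longleftrightarrow> x = 0 \<or> 0 < V x" for x by (simp add: E_def val_ideal_type)
  have \<kappa>R: "\<kappa> a \<in> val_ring E V" if "a \<in> val_ring K w'" for a
    using that V(1)[of a] by (cases "a = 0") (auto simp: Rk Rl \<kappa>0)
  have \<kappa>U: "V (\<kappa> a) = 0 \<longleftrightarrow> w' a = 0" if "a \<noteq> 0" for a
    using V[OF that] by (auto simp: order_le_less)
  have res_eq: "res a = res b \<longleftrightarrow> a - b \<in> val_ideal K w'" if "a \<in> val_ring K w'" "b \<in> val_ring K w'" for a b
    using residue_eq_iff[OF vals(1) that] by (simp add: res_def K_def)
  have Res_eq: "Res a = Res b \<longleftrightarrow> a - b \<in> val_ideal E V" if "a \<in> val_ring E V" "b \<in> val_ring E V" for a b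
    using residue_eq_iff[OF vals(2) that] by (simp add: Res_def E_def)
  have Res_minus: "Res x \<ominus>\<^bsub>l\<^esub> Res y = Res (x - y)" if "x \<in> val_ring E V" "y \<in> val_ring E V" for x y
    using residue_minus[OF vals(2) that] by (simp add: Res_def l_def E_def)
  have ops: "x \<otimes>\<^bsub>K\<^esub> y = x * y" "x \<oplus>\<^bsub>K\<^esub> y = x + y" "S \<otimes>\<^bsub>E\<^esub> T = S * T" "S \<oplus>\<^bsub>E\<^esub> T = S + T"
    "\<zero>\<^bsub>K\<^esub> = 0" "\<one>\<^bsub>K\<^esub> = 1" "\<zero>\<^bsub>E\<^esub> = 0" "\<one>\<^bsub>E\<^esub> = 1" for x y S T
    by (simp_all add: K_def E_def)
  have res0: "res a = \<zero>\<^bsub>k\<^esub> \<longleftrightarrow> a \<in> val_ideal K w'" if "a \<in> val_ring K w'" for a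
    using res_eq[OF that, of 0] by (simp add: ks ops Rk)
  have Res0: "Res x = \<zero>\<^bsub>l\<^esub> \<longleftrightarrow> x \<in> val_ideal E V" if "x \<in> val_ring E V" for x
    using Res_eq[OF that, of 0] by (simp add: ls ops Rl)
  have wbv: "valuation k wb" and wbr: "val_ring k wb = res ` val_ring K w"
    using wb by (auto simp: induced_valuation_def k_def res_def K_def)
  have unit: "\<exists>a. a \<noteq> 0 \<and> w' a = 0 \<and> A = res a" if "A \<in> carrier k" "A \<noteq> \<zero>\<^bsub>k\<^esub>" for A
    using that res0 by (fastforce simp: ks(1) Rk Ik)
  have Unit: "\<exists>x. x \<noteq> 0 \<and> V x = 0 \<and> S = Res x" if "S \<in> carrier l" "S \<noteq> \<zero>\<^bsub>l\<^esub>" for S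
    using that Res0 by (fastforce simp: ls(1) Rl Il)
  have resU: "res a \<in> carrier k \<and> res a \<noteq> \<zero>\<^bsub>k\<^esub>" if "a \<noteq> 0" "w' a = 0" for a
    using that res0[of a] by (auto simp: ks(1) Rk Ik)
  have ResU: "Res x \<in> carrier l \<and> Res x \<noteq> \<zero>\<^bsub>l\<^esub>" if "x \<noteq> 0" "V x = 0" for x
    using that Res0[of x] by (auto simp: ls(1) Rl Il)
  have wb_nonneg: "0 \<le> wb (res a) \<longleftrightarrow> 0 \<le> w a" if a: "a \<noteq> 0" "w' a = 0" for a
  proof -
    have "0 \<le> wb (res a) \<longleftrightarrow> res a \<in> res ` val_ring K w"
      unfolding wbr[symmetric] using resU[OF a] by (simp add: val_ring_def)
    also have "\<dots> \<longleftrightarrow> 0 \<le> w a"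
    proof
      assume "res a \<in> res ` val_ring K w"
      then obtain c where c: "c = 0 \<or> 0 \<le> w c" "res a = res c" by (auto simp: K_def val_ring_type)
      have "c \<in> val_ring K w'" using c coarsening_le[OF coarse(1), of 1 c] by (auto simp: Rk)
      then have d: "a - c = 0 \<or> 0 < w' (a - c)" using res_eq[of a c] c a by (auto simp: Rk Ik)
      show "0 \<le> w a"
      proof (rule ccontr)
        assume "\<not> 0 \<le> w a"
        then have "below w c a" using c a by (auto simp: below_def)
        moreover have "below w (a - c) a"
          using d a coarsening_le[OF coarse(1), of "a - c" a] by (auto simp: below_def not_le[symmetric])
        ultimately have "below w ((a - c) + c) a" using w.below_add by blast
        then show False by (simp add: below_def)
      qed
    next
      assume "0 \<le> w a"
      then show "res a \<in> res ` val_ring K w" by (auto simp: K_def val_ring_type)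
    qed
    finally show ?thesis .
  qed
  have wb_mult: "wb (res (a * b)) = wb (res a) + wb (res b)"
    if "a \<noteq> 0" "w' a = 0" "b \<noteq> 0" "w' b = 0" for a b
    using val_mult[OF wbv, of "res a" "res b"] resU that ks(4)[of a b] by (simp add: ops Rk)
  have wb_le: "wb (res a) \<le> wb (res b) \<longleftrightarrow> w a \<le> w b"
    if ab: "a \<noteq> 0" "w' a = 0" "b \<noteq> 0" "w' b = 0" for a b
  proof -
    have "wb (res (a * (b / a))) = wb (res a) + wb (res (b / a))"
      using ab by (intro wb_mult) (auto simp: w'.divide)
    then show ?thesis using wb_nonneg[of "b / a"] ab by (simp add: w'.divide w.divide)
  qed
  define \<alpha> where "\<alpha> S = (SOME a. a \<noteq> 0 \<and> w' a = 0 \<and> (\<exists>x. x \<noteq> 0 \<and> V x = 0 \<and> S = Res x \<and> W (\<kappa> a) = W x))" for S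
  define u where "u S = wb (res (\<alpha> S))" for S
  have app: "\<exists>a. a \<noteq> 0 \<and> w' a = 0 \<and> W (\<kappa> a) = W x \<and> below W (x - \<kappa> a) x" if x: "x \<noteq> 0" "V x = 0" for x
  proof -
    obtain a where a: "below W (x - \<kappa> a) x" using approx[OF x] by blast
    then have "W.close (\<kappa> a) x" by (simp add: W.close_def W.below_diff_commute)
    from W.close_nz[OF this] have "\<kappa> a \<noteq> 0" "W (\<kappa> a) = W x" by auto
    have "V (\<kappa> a) = V x"
      by (rule coarsening_eq[OF coarse(2) \<open>\<kappa> a \<noteq> 0\<close> x(1) \<open>W (\<kappa> a) = W x\<close>])
    moreover have "a \<noteq> 0" using \<open>\<kappa> a \<noteq> 0\<close> \<kappa>0 by metis
    ultimately have "a \<noteq> 0 \<and> w' a = 0 \<and> W (\<kappa> a) = W x \<and> below W (x - \<kappa> a) x"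
      using \<kappa>U[of a] x(2) \<open>W (\<kappa> a) = W x\<close> a by simp
    then show ?thesis ..
  qed
  have u_eq: "u (Res x) = wb (res a)"
    if x: "x \<noteq> 0" "V x = 0" and a: "a \<noteq> 0" "w' a = 0" "W (\<kappa> a) = W x" for x a
  proof -
    have "\<exists>a. a \<noteq> 0 \<and> w' a = 0 \<and> (\<exists>y. y \<noteq> 0 \<and> V y = 0 \<and> Res x = Res y \<and> W (\<kappa> a) = W y)"
      using x a by blast
    from someI_ex[OF this, folded \<alpha>_def] obtain y
      where y: "y \<noteq> 0" "V y = 0" "Res x = Res y" "W (\<kappa> (\<alpha> (Res x))) = W y"
        and \<alpha>: "\<alpha> (Res x) \<noteq> 0" "w' (\<alpha> (Res x)) = 0" by blast
    have "x - y = 0 \<or> 0 < V (x - y)" using Res_eq[of x y] x y by (auto simp: Rl Il)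
    then have "below W (x - y) y"
      using y coarsening_le[OF coarse(2), of "x - y" y] by (auto simp: below_def not_le[symmetric])
    then have "W x = W y" using W.close_nz[of x y] by (simp add: W.close_def)
    then have "W (\<kappa> (\<alpha> (Res x))) = W (\<kappa> a)" using y(4) a(3) by metis
    then have "w (\<alpha> (Res x)) \<le> w a" "w a \<le> w (\<alpha> (Res x))"
      using W[OF a(1) \<alpha>(1)] W[OF \<alpha>(1) a(1)] by auto
    then show ?thesis
      unfolding u_def using wb_le[OF a(1,2) \<alpha>] wb_le[OF \<alpha> a(1,2)] by (intro antisym) simp_all
  qed
  have uv: "valuation l u"
    unfolding valuation_def
  proof (intro conjI ballI impI)
    fix S T assume "S \<in> carrier l - {\<zero>\<^bsub>l\<^esub>}" "T \<in> carrier l - {\<zero>\<^bsub>l\<^esub>}"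
    then obtain x y where x: "x \<noteq> 0" "V x = 0" "S = Res x" and y: "y \<noteq> 0" "V y = 0" "T = Res y"
      using Unit by blast
    have xr: "x \<in> val_ring E V" "y \<in> val_ring E V" using x y by (auto simp: Rl)
    obtain a b where a: "a \<noteq> 0" "w' a = 0" "W (\<kappa> a) = W x" and b: "b \<noteq> 0" "w' b = 0" "W (\<kappa> b) = W y"
      using app[OF x(1,2)] app[OF y(1,2)] by blast
    have uS: "u S = wb (res a)" "u T = wb (res b)" using u_eq x y a b by auto
    have "u (Res (x * y)) = wb (res (a * b))"
      using x y a b \<kappa>nz by (intro u_eq) (auto simp: V.mult w'.mult hom W.mult)
    then show "u (S \<otimes>\<^bsub>l\<^esub> T) = u S + u T"
      using x y a b xr wb_mult uS by (simp add: ls ops)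
    assume nz: "S \<oplus>\<^bsub>l\<^esub> T \<noteq> \<zero>\<^bsub>l\<^esub>"
    have ST: "S \<oplus>\<^bsub>l\<^esub> T = Res (x + y)" using x y xr by (simp add: ls ops)
    have "x + y \<in> val_ring E V" using subringE(7)[OF val_ring_subring[OF vals(2)]] xr ops by metis
    then have xy: "x + y \<noteq> 0" "V (x + y) = 0"
      using nz Res0[of "x + y"] unfolding ST by (auto simp: Rl Il)
    obtain c where c: "c \<noteq> 0" "w' c = 0" "W (\<kappa> c) = W (x + y)" using app[OF xy] by blast
    have "W x \<le> W (x + y) \<or> W y \<le> W (x + y)" using W.add[OF x(1) y(1) xy(1)] by (auto simp: min_def split: if_splits)
    then have "w a \<le> w c \<or> w b \<le> w c" using W[of a c] W[of b c] a b c by auto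
    then have "wb (res a) \<le> wb (res c) \<or> wb (res b) \<le> wb (res c)" using wb_le a b c by blast
    then show "min (u S) (u T) \<le> u (S \<oplus>\<^bsub>l\<^esub> T)"
      unfolding uS ST u_eq[OF xy c] by (auto simp: min_def)
  qed (rule l.field_axioms)
  define h where "h A = Res (\<kappa> (SOME a. a \<in> val_ring K w' \<and> A = res a))" for A
  have h: "h (res a) = Res (\<kappa> a)" if a: "a \<in> val_ring K w'" for a
  proof -
    define b where "b = (SOME b. b \<in> val_ring K w' \<and> res a = res b)"
    have b: "b \<in> val_ring K w'" "res a = res b"
      using someI[of "\<lambda>b. b \<in> val_ring K w' \<and> res a = res b" a] a by (auto simp: b_def)
    then have "b - a \<in> val_ideal K w'" using res_eq[OF b(1) a] by simp
    then have "\<kappa> b - \<kappa> a \<in> val_ideal E V" using V(2)[of "b - a"]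
      by (cases "b = a") (auto simp: Ik Il \<kappa>m[symmetric] \<kappa>0)
    then show ?thesis using Res_eq[OF \<kappa>R[OF b(1)] \<kappa>R[OF a]] by (simp add: h_def b_def)
  qed
  have sub: "a * b \<in> val_ring K w'" "a + b \<in> val_ring K w'"
    if "a \<in> val_ring K w'" "b \<in> val_ring K w'" for a b
    using subringE(6,7)[OF val_ring_subring[OF vals(1)]] that ops by metis+
  have hh: "h \<in> ring_hom k l"
    using \<kappa>R sub by (intro ring_hom_memI) (auto simp: ks ls ops h hom Rk[of 1])
  have "valued_extension k wb l u h"
    unfolding valued_extension_def
  proof (intro conjI ballI wbv uv hh)
    fix A assume "A \<in> carrier k - {\<zero>\<^bsub>k\<^esub>}"
    then obtain a where a: "a \<noteq> 0" "w' a = 0" "A = res a" using unit by blast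
    then show "u (h A) = wb A" using u_eq[of "\<kappa> a" a] \<kappa>nz \<kappa>U by (simp add: h Rk)
  qed
  moreover have "\<exists>A\<in>carrier k. S \<ominus>\<^bsub>l\<^esub> h A = \<zero>\<^bsub>l\<^esub> \<or> u S < u (S \<ominus>\<^bsub>l\<^esub> h A)"
    if S: "S \<in> carrier l" "S \<noteq> \<zero>\<^bsub>l\<^esub>" for S
  proof -
    obtain x where x: "x \<noteq> 0" "V x = 0" "S = Res x" using Unit[OF S] by blast
    obtain a where a: "a \<noteq> 0" "w' a = 0" "W (\<kappa> a) = W x" "below W (x - \<kappa> a) x"
      using app[OF x(1,2)] by blast
    have ar: "a \<in> val_ring K w'" "x \<in> val_ring E V" using a x by (auto simp: Rk Rl)
    have eq: "S \<ominus>\<^bsub>l\<^esub> h (res a) = Res (x - \<kappa> a)" using x ar \<kappa>R by (simp add: h Res_minus)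
    have "u S < u (Res (x - \<kappa> a))" if nz: "Res (x - \<kappa> a) \<noteq> \<zero>\<^bsub>l\<^esub>"
    proof -
      have "x - \<kappa> a \<in> val_ring E V"
        using coarsening_le[OF coarse(2) x(1), of "x - \<kappa> a"] a(4) x(2)
        by (cases "x - \<kappa> a = 0") (auto simp: below_def Rl)
      then have y: "x - \<kappa> a \<noteq> 0" "V (x - \<kappa> a) = 0" using nz Res0[of "x - \<kappa> a"] by (auto simp: Rl Il)
      obtain b where b: "b \<noteq> 0" "w' b = 0" "W (\<kappa> b) = W (x - \<kappa> a)" using app[OF y] by blast
      have "\<not> W (\<kappa> b) \<le> W (\<kappa> a)" using a b y by (auto simp: below_def)
      then have "\<not> wb (res b) \<le> wb (res a)" using W wb_le a b by blast
      then show ?thesis using u_eq[OF x(1,2) a(1-3)] u_eq[OF y b] x by simp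
    qed
    then show ?thesis using eq resU a by metis
  qed
  ultimately show ?thesis using h unfolding k_def l_def K_def E_def res_def Res_def by blast
qed

section \<open>Nests of balls over a maximal residue field\<close>

text \<open>
  Lists are coded with an injective pairing, with the length recorded so that the end of the list can
  be recognised.
\<close>

lemma infinite_inj_list:
  assumes inf: "infinite (UNIV :: 'a set)"
  shows "\<exists>e :: 'a list \<Rightarrow> 'a. inj e"
proof -
  have "|(UNIV :: 'a set) \<times> (UNIV :: 'a set)| \<le>o |UNIV :: 'a set|"
    using card_of_Times_same_infinite[OF inf] ordIso_iff_ordLeq by blast
  then obtain pair :: "'a \<times> 'a \<Rightarrow> 'a" where pair: "inj pair"
    unfolding card_of_ordLeq[symmetric] by auto
  obtain num :: "nat \<Rightarrow> 'a" where num: "inj num"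
    using infinite_countable_subset[OF inf] by blast
  define enc where "enc = (\<lambda>xs. foldr (\<lambda>x y. pair (x, y)) xs (num 0))"
  have enc: "xs = ys" if "length xs = length ys" "enc xs = enc ys" for xs ys
    using that by (induction xs ys rule: list_induct2) (auto simp: enc_def inj_eq[OF pair])
  have "inj (\<lambda>xs. pair (num (length xs), enc xs))"
    using enc by (auto intro!: injI simp: inj_eq[OF pair] inj_eq[OF num])
  then show ?thesis by blast
qed

lemma infinite_inj_poly_fract:
  assumes inf: "infinite (UNIV :: 'a::field set)"
  shows "\<exists>e :: 'a poly fract \<Rightarrow> 'a. inj e"
proof -
  obtain e :: "'a list \<Rightarrow> 'a" where e: "inj e" using infinite_inj_list[OF inf] by blast
  define num den where "num x = (SOME q. \<exists>r. x = Fract q r)"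
    and "den x = (SOME r. x = Fract (num x) r)" for x :: "'a poly fract"
  have x: "x = Fract (num x) (den x)" for x
  proof -
    have "\<exists>q r. x = Fract q r" by (cases x) auto
    then have "\<exists>r. x = Fract (num x) r" unfolding num_def by (rule someI_ex)
    then show ?thesis unfolding den_def by (rule someI_ex)
  qed
  have "inj (\<lambda>x. e [e (coeffs (num x)), e (coeffs (den x))])"
    using x by (auto intro!: injI simp: inj_eq[OF e] coeffs_eq_iff[symmetric]) metis
  then show ?thesis by blast
qed

text \<open>
  If the nest had no common point, the residue of \<open>X\<close> would lie in the immediate extension of \<open>Kw'\<close>
  that the composite valuation provides. By maximality it would be the residue of some \<open>b\<close> in \<open>K\<close>. But
  \<open>X - x\<close> is smaller than the radius for each point \<open>x\<close> of a ball, and \<open>X - b\<close> is smaller than every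
  radius because the radii are \<open>w'\<close>-units; so \<open>b\<close> would belong to all the balls.
\<close>

lemma maximal_residue_ball_nest:
  fixes w :: "'a::field \<Rightarrow> 'g::linordered_ab_group_add" and w' :: "'a \<Rightarrow> 'h::linordered_ab_group_add"
    and wb :: "'a set \<Rightarrow> 'k::linordered_ab_group_add"
  assumes inf: "infinite (UNIV :: 'a set)"
    and coarse: "coarsening ring_of_type_algebra w' w"
    and wb: "induced_valuation ring_of_type_algebra w w' wb"
    and maximal: "maximal_valued_field (residue_field ring_of_type_algebra w') wb"
    and nonempty: "C \<noteq> {}"
    and chain: "\<And>A B. A \<in> C \<Longrightarrow> B \<in> C \<Longrightarrow> A \<subseteq> B \<or> B \<subseteq> A"
    and balls: "\<And>B. B \<in> C \<Longrightarrow> \<exists>c r. r \<noteq> 0 \<and> w' r = 0 \<and> (c = 0 \<or> 0 \<le> w' c) \<and>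
      B = {x. below w (x - c) r}"
  shows "\<Inter>C \<noteq> {}"
proof
  assume no_limit: "\<Inter>C = {}"
  define K where "K = (ring_of_type_algebra :: 'a ring)"
  define E where "E = (ring_of_type_algebra :: 'a poly fract ring)"
  interpret ball_nest w C
    using coarse nonempty chain balls no_limit by unfold_locales (auto simp: coarsening_def, blast)
  obtain p where "good_modulus p" using good_modulus_exists by blast
  then interpret ball_nest_modulus w C p by unfold_locales
  interpret w': valued_field w' using coarse by unfold_locales (simp add: coarsening_def)
  define V where "V = fract_val w'"
  have V: "valuation E V" using fract_val_valuation[OF coarse] by (simp add: V_def E_def)
  interpret V: valued_field V using V by unfold_locales (simp add: E_def)
  have Vc: "V (const_fract a) = (0, w' a)" if "a \<noteq> 0" for a
    using fract_val_const[OF coarse that] by (simp add: V_def)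
  have Wc: "fract_val w (const_fract a) = (0, w a)" if "a \<noteq> 0" for a
    by (rule fract_val_const[OF coarsening_self that])
  obtain u h where ext: "valued_extension (residue_field K w') wb (residue_field E V) u h"
    and h: "\<And>a. a \<in> val_ring K w' \<Longrightarrow> h (residue K w' a) = residue E V (const_fract a)"
    and approx: "\<And>S. S \<in> carrier (residue_field E V) \<Longrightarrow> S \<noteq> \<zero>\<^bsub>residue_field E V\<^esub> \<Longrightarrow>
      \<exists>A\<in>carrier (residue_field K w'). S \<ominus>\<^bsub>residue_field E V\<^esub> h A = \<zero>\<^bsub>residue_field E V\<^esub> \<or>
          u S < u (S \<ominus>\<^bsub>residue_field E V\<^esub> h A)"
    using residue_extension[OF coarse fract_val_coarsening[OF coarse] wb const_fract_hom(1,2,3)]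
      Vc Wc fract_val_immediate[OF coarse]
    unfolding K_def E_def V_def by (auto simp: less_eq_prod_def less_prod_def' zero_prod_def)
  obtain e :: "'a poly fract \<Rightarrow> 'a" where e: "inj e" using infinite_inj_poly_fract[OF inf] by blast
  define rep where "rep S = (SOME x. S = residue E V x)" for S
  have rep: "S = residue E V (rep S)" if "S \<in> carrier (residue_field E V)" for S
  proof -
    have "\<exists>x. S = residue E V x" using that by (auto simp: residue_field_simps(1)[OF V])
    then show ?thesis unfolding rep_def by (rule someI_ex)
  qed
  have "inj_on (\<lambda>S. {{e (rep S)}}) (carrier (residue_field E V))"
    using rep by (intro inj_onI) (metis inj_eq[OF e] singleton_inject)
  from maximal_valued_field_surj[OF maximal[folded K_def] ext approx this]
  have surj: "h ` carrier (residue_field K w') = carrier (residue_field E V)" by simp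
  have limit: "indeterminate - const_fract b \<in> val_ideal E V \<Longrightarrow> False" for b
  proof -
    assume b: "indeterminate - const_fract b \<in> val_ideal E V"
    obtain d where d: "quotient_lead (indeterminate - const_fract b) 0 d" "late (\<lambda>x. x - b \<doteq> d)"
      by (rule quotient_lead_linear)
    have d0: "d \<noteq> 0" "indeterminate - const_fract b \<noteq> 0" using quotient_lead_nz[OF d(1)] by auto
    then have wd: "0 < w' d"
      using b fract_val_eq[OF coarse d(1)] by (auto simp: E_def val_ideal_type V_def less_prod_def' zero_prod_def)
    have "b \<in> B" if B: "B \<in> C" for B
    proof -
      obtain c r where c: "r \<noteq> 0" "w' r = 0" "B = {x. below w (x - c) r}" using balls[OF B] by blast
      have "late (\<lambda>x. x \<in> B)" using B by (auto simp: late_def)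
      then obtain x where x: "x - b \<doteq> d" "x \<in> B" 
      using late_ex[OF late_conj[OF d(2)]] by metis
      have "d \<lless> r"
        using coarsening_le[OF coarse d0(1) c(1)] wd c(1,2) by (auto simp: below_def simp flip: not_le)
      then have "x - b \<lless> r" using close_below(2)[OF x(1)] by blast
      moreover have "x - c \<lless> r" using x(2) c(3) by simp
      ultimately have "(x - c) - (x - b) \<lless> r" using below_diff by blast
      then show ?thesis using c by simp
    qed
    then show False using no_limit by blast
  qed
  have "indeterminate \<in> val_ring E V"
  proof -
    obtain B where B: "B \<in> C" using nonempty by blast
    obtain c r where c: "r \<noteq> 0" "w' r = 0" "c = 0 \<or> 0 \<le> w' c" "B = {x. below w (x - c) r}"
      using balls[OF B] by blast
    obtain d where d: "quotient_lead (indeterminate - const_fract c) 0 d" "late (\<lambda>x. x - c \<doteq> d)"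
      by (rule quotient_lead_linear)
    have "late (\<lambda>x. x \<in> B)" using B by (auto simp: late_def)
    then obtain x where x: "x - c \<doteq> d" "x \<in> B" 
      using late_ex[OF late_conj[OF d(2)]] by metis
    have "d \<lless> r" using x c close_below(2)[OF x(1)] by blast
    then have "0 \<le> w' d"
      using coarsening_le[OF coarse c(1), of d] c quotient_lead_nz[OF d(1)] by (auto simp: below_def)
    then have "indeterminate - const_fract c \<in> val_ring E V"
      using fract_val_eq[OF coarse d(1)] by (auto simp: E_def val_ring_type V_def less_eq_prod_def zero_prod_def)
    moreover have "const_fract c \<in> val_ring E V"
      using c(3) Vc[of c] by (cases "c = 0") (auto simp: E_def val_ring_type const_fract_hom less_eq_prod_def zero_prod_def)
    ultimately have "(indeterminate - const_fract c) \<oplus>\<^bsub>E\<^esub> const_fract c \<in> val_ring E V"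
      by (rule subringE(7)[OF val_ring_subring[OF V]])
    then show ?thesis by (simp add: E_def)
  qed
  note ind = this
  then have "residue E V indeterminate \<in> carrier (residue_field E V)"
    by (simp add: residue_field_simps(1)[OF V])
  then obtain A where A: "A \<in> carrier (residue_field K w')" "residue E V indeterminate = h A"
    using surj by blast
  have "valuation K w'" using coarse by (simp add: coarsening_def K_def)
  from A(1)[unfolded residue_field_simps(1)[OF this]] obtain b
    where b: "b \<in> val_ring K w'" "A = residue K w' b" by blast
  have "const_fract b \<in> val_ring E V"
    using b Vc[of b] by (cases "b = 0") (auto simp: E_def K_def val_ring_type const_fract_hom less_eq_prod_def zero_prod_def)
  then have "indeterminate - const_fract b \<in> val_ideal E V"
    using residue_eq_iff[OF V ind, of "const_fract b"] A(2) b h[OF b(1)] by (simp add: E_def)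
  then show False by (rule limit)
qed

section \<open>Towers of exponents\<close>

text \<open>
  The valuation ring of the natural valuation, and hence of any coarsening of it, contains all elements
  between \<open>-1\<close> and \<open>1\<close>.
\<close>

lemma convex_valuation:
  fixes w :: "'a::linordered_field \<Rightarrow> 'g::linordered_ab_group_add"
  assumes coarse: "coarsening ring_of_type_algebra w natural_valuation"
    and xy: "x \<noteq> 0" "y \<noteq> 0" "\<bar>x\<bar> \<le> \<bar>y\<bar>"
  shows "w y \<le> w x"
proof -
  interpret valued_field w using coarse by unfold_locales (simp add: coarsening_def)
  have "\<bar>x / y\<bar> \<le> 1" using xy by (simp add: abs_divide)
  then have "of_int (- 1) \<le> x / y \<and> x / y \<le> of_int 1"
    by (simp add: abs_le_iff minus_le_iff del: abs_divide)
  then have "x / y \<in> val_ring ring_of_type_algebra natural_valuation"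
    unfolding val_ring_natural_valuation by blast
  then have "x / y \<in> val_ring ring_of_type_algebra w" using coarse by (auto simp: coarsening_def)
  then show ?thesis using xy by (simp add: val_ring_type divide)
qed

locale compatible_exponential =
  fixes f :: "'a::linordered_field \<Rightarrow> 'a"
    and w :: "'a \<Rightarrow> 'g::linordered_ab_group_add" and w' :: "'a \<Rightarrow> 'h::linordered_ab_group_add"
  assumes exp: "exponential f"
    and natural: "coarsening ring_of_type_algebra w natural_valuation"
    and comp: "compatible f w"
    and coarse: "coarsening ring_of_type_algebra w' w"
begin

sublocale valued_field w using natural by unfold_locales (simp add: coarsening_def)

sublocale w': valued_field w' using coarse by unfold_locales (simp add: coarsening_def)

lemma f_pos [simp]: "0 < f x" "f x \<noteq> 0"
proof -
  show "0 < f x" using exp by (auto simp: exponential_def bij_betw_def)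
  then show "f x \<noteq> 0" by simp
qed

lemma f_add: "f (x + y) = f x * f y" and f_less: "f x < f y \<longleftrightarrow> x < y"
  using exp by (auto simp: exponential_def)

lemma f_zero [simp]: "f 0 = 1"
  using f_add[of 0 0] by simp

lemma f_onto: "0 < y \<Longrightarrow> \<exists>x. f x = y"
  using exp by (auto simp: exponential_def bij_betw_def image_iff) (metis greaterThan_iff image_iff)

lemma w_f_add: "w (f (x + y)) = w (f x) + w (f y)"
  by (simp add: f_add mult)

lemma w_f_mono: "x \<le> y \<Longrightarrow> w (f y) \<le> w (f x)"
proof -
  assume "x \<le> y"
  then have "f x \<le> f y" using f_less by (auto simp: order_le_less)
  then show ?thesis by (intro convex_valuation[OF natural]) (auto simp: abs_of_pos)
qed

text \<open>
  Together with additivity and monotonicity, this identifies the value group with \<open>K\<close> modulo the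
  valuation ring, in reversed order.
\<close>

lemma w_f_eq_0: "w (f x) = 0 \<longleftrightarrow> x = 0 \<or> 0 \<le> w x"
proof -
  have inj: "inj f" using exp by (simp add: exponential_def bij_betw_def)
  have "w (f x) = 0 \<longleftrightarrow> f x \<in> f ` val_ring ring_of_type_algebra w"
    using comp by (simp add: compatible_def)
  also have "\<dots> \<longleftrightarrow> x \<in> val_ring ring_of_type_algebra w" by (rule inj_image_mem_iff[OF inj])
  finally show ?thesis by (simp add: val_ring_type)
qed

lemma w_f_neg: "w (f x) < 0 \<longleftrightarrow> 0 < x \<and> w x < 0"
proof
  assume *: "w (f x) < 0"
  then have "0 < x" using w_f_mono[of x 0] by (auto simp: not_less[symmetric])
  then show "0 < x \<and> w x < 0" using * w_f_eq_0[of x] by (auto simp: not_le)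
next
  assume *: "0 < x \<and> w x < 0"
  then have "w (f x) \<le> 0" using w_f_mono[of 0 x] by simp
  then show "w (f x) < 0" using * w_f_eq_0[of x] by auto
qed

lemma coarse_between:
  assumes "w (f x) \<le> w (f y)" "w (f y) < 0" "w' (f x) = 0" shows "w' (f y) = 0"
  using coarsening_le[OF coarse f_pos(2) f_pos(2) assms(1)]
    coarsening_le[OF coarse f_pos(2) one_neq_zero, of y] assms by simp

text \<open>
  The condition \<open>w (f (\<sigma> n)) < 0\<close> says that \<open>\<sigma> n\<close> is positive and infinitely large with respect to
  \<open>w\<close>, see \<open>w_f_neg\<close>. The third condition makes room for subtracting \<open>f (\<sigma> (Suc n))\<close> from \<open>\<sigma> n\<close>.
\<close>

definition tower :: "(nat \<Rightarrow> 'a) \<Rightarrow> bool" where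
  "tower \<sigma> \<longleftrightarrow> (\<forall>n. w (f (\<sigma> n)) < 0 \<and> w' (f (\<sigma> n)) = 0 \<and> w (\<sigma> n) < w (f (\<sigma> (Suc n))))"

definition descends :: "(nat \<Rightarrow> 'a) \<Rightarrow> (nat \<Rightarrow> 'a) \<Rightarrow> bool" where
  "descends \<sigma> \<tau> \<longleftrightarrow> (\<forall>n. \<sigma> n - \<tau> n \<doteq> f (\<sigma> (Suc n)))"

text \<open>
  The difference \<open>e = \<sigma> n - \<tau> n\<close> is close to \<open>f (\<sigma> (Suc n))\<close>, hence positive and infinitely large.
  As it is infinitely smaller than \<open>\<sigma> n\<close>, the element \<open>\<tau> n\<close> is still positive and has the same value as
  \<open>\<sigma> n\<close>. As \<open>w (f e) < 0\<close>, the quotient \<open>f (\<tau> n) = f (\<sigma> n) / f e\<close> has greater value than \<open>f (\<sigma> n)\<close>.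
\<close>

lemma descends_tower:
  assumes \<sigma>: "tower \<sigma>" and d: "descends \<sigma> \<tau>"
  shows "tower \<tau>" and "w (f (\<sigma> n)) < w (f (\<tau> n))"
proof -
  have s: "w (f (\<sigma> n)) < 0" "w' (f (\<sigma> n)) = 0" "w (\<sigma> n) < w (f (\<sigma> (Suc n)))" "0 < \<sigma> n" "w (\<sigma> n) < 0" for n
    using \<sigma> w_f_neg[of "\<sigma> n"] by (auto simp: tower_def)
  have *: "w (\<tau> n) = w (\<sigma> n) \<and> w (f (\<tau> n)) < 0 \<and> w (f (\<sigma> n)) < w (f (\<tau> n))" for n
  proof -
    define g where "g = f (\<sigma> (Suc n))"
    define e where "e = \<sigma> n - \<tau> n"
    have eg: "e \<doteq> g" using d by (simp add: descends_def e_def g_def)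
    then have we: "w e = w g" "e \<noteq> 0" using close_nz by auto
    have "0 < e"
    proof (rule ccontr)
      assume "\<not> 0 < e"
      moreover have "0 < g" by (simp add: g_def)
      ultimately have "\<bar>g\<bar> \<le> \<bar>e - g\<bar>" "e - g \<noteq> 0" by (auto simp: abs_of_neg)
      then have "w (e - g) \<le> w g" by (intro convex_valuation[OF natural]) (auto simp: g_def)
      then show False using eg \<open>e - g \<noteq> 0\<close> by (auto simp: close_def below_def)
    qed
    have "\<sigma> n \<doteq> \<tau> n"
    proof -
      have "e \<lless> \<sigma> n" using s(3,4)[of n] we by (auto simp: below_def g_def)
      then have "\<tau> n \<doteq> \<sigma> n" by (simp add: close_def e_def below_diff_commute)
      then show ?thesis by (rule close_sym)
    qed
    then have wt: "w (\<tau> n) = w (\<sigma> n)" "\<tau> n \<noteq> 0" using close_nz by auto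
    have "0 < \<tau> n"
    proof (rule ccontr)
      assume "\<not> 0 < \<tau> n"
      then have "\<bar>\<sigma> n\<bar> \<le> \<bar>e\<bar>" using s(4)[of n] by (simp add: e_def abs_if)
      then have "w e \<le> w (\<sigma> n)"
        using s(4)[of n] we by (intro convex_valuation[OF natural]) auto
      then show False using we s(3)[of n] by (simp add: g_def)
    qed
    then have "w (f (\<tau> n)) < 0" using w_f_neg wt s by simp
    moreover have "w (f e) < 0" using w_f_neg[of e] \<open>0 < e\<close> we s(1)[of "Suc n"] by (simp add: g_def)
    then have "w (f (\<sigma> n)) < w (f (\<tau> n))" using w_f_add[of "\<tau> n" e] by (simp add: e_def)
    ultimately show ?thesis using wt by simp
  qed
  then show "w (f (\<sigma> n)) < w (f (\<tau> n))" by blast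
  show "tower \<tau>"
    unfolding tower_def
  proof (intro allI conjI)
    fix n
    show "w (f (\<tau> n)) < 0" using * by blast
    show "w (\<tau> n) < w (f (\<tau> (Suc n)))" 
      using *[of n] *[of "Suc n"] less_trans[OF s(3)[of n], of "w (f (\<tau> (Suc n)))"] by simp
    show "w' (f (\<tau> n)) = 0" 
      by (rule coarse_between[of "\<sigma> n"]) (use *[of n] s(2)[of n] in \<open>simp_all add: order_less_imp_le\<close>)
  qed
qed

lemma descends_irrefl: "\<not> descends \<sigma> \<sigma>"
  by (auto simp: descends_def close_def below_def)

lemma descends_trans:
  assumes "tower \<sigma>" "descends \<sigma> \<tau>" "descends \<tau> \<rho>" shows "descends \<sigma> \<rho>"
  unfolding descends_def
proof
  fix n
  have "f (\<tau> (Suc n)) \<lless> f (\<sigma> (Suc n))"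
    using descends_tower(2)[OF assms(1,2), of "Suc n"] by (simp add: below_def)
  moreover have "\<tau> n - \<rho> n \<doteq> f (\<tau> (Suc n))" using assms(3) by (simp add: descends_def)
  ultimately have "\<tau> n - \<rho> n \<lless> f (\<sigma> (Suc n))" using close_below(2) by blast
  moreover have "(\<sigma> n - \<tau> n) - f (\<sigma> (Suc n)) \<lless> f (\<sigma> (Suc n))"
    using assms(2) by (simp add: descends_def close_def)
  ultimately have "(\<tau> n - \<rho> n) + ((\<sigma> n - \<tau> n) - f (\<sigma> (Suc n))) \<lless> f (\<sigma> (Suc n))"
    by (rule below_add)
  moreover have "(\<tau> n - \<rho> n) + ((\<sigma> n - \<tau> n) - f (\<sigma> (Suc n))) = \<sigma> n - \<rho> n - f (\<sigma> (Suc n))"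
    by simp
  ultimately show "\<sigma> n - \<rho> n \<doteq> f (\<sigma> (Suc n))" by (simp only: close_def)
qed

lemma descends_exists: "\<exists>\<tau>. descends \<sigma> \<tau>"
  by (rule exI[of _ "\<lambda>n. \<sigma> n - f (\<sigma> (Suc n))"]) (simp add: descends_def)

text \<open>
  Given \<open>\<sigma> n = x\<close>, the next entry must name a value strictly between \<open>0\<close> and both \<open>w x\<close> and
  \<open>w (f x)\<close>, the latter in order to stay among the \<open>w'\<close>-units. Halving the logarithm of the smaller
  of \<open>x\<close> and \<open>f x\<close> produces it: values of exponentials can be divided by 2.
\<close>

lemma tower_exists:
  assumes a: "a \<noteq> 0" "w' a = 0" "w a \<noteq> 0"
  shows "\<exists>\<sigma>. tower \<sigma>"
proof -
  define b where "b = (if w a < 0 then \<bar>a\<bar> else \<bar>inverse a\<bar>)"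
  have abs: "w \<bar>x\<bar> = w x" "w' \<bar>x\<bar> = w' x" for x by (simp_all add: abs_if)
  have b: "0 < b" "w b < 0" "w' b = 0"
    using a by (auto simp: b_def abs inverse w'.inverse)
  define Q where "Q x \<longleftrightarrow> w (f x) < 0 \<and> w' (f x) = 0" for x
  obtain x0 where "f x0 = b" using f_onto b by blast
  then have x0: "Q x0" using b by (simp add: Q_def)
  have "\<exists>y. Q y \<and> w x < w (f y)" if x: "Q x" for x
  proof -
    have pos: "0 < x" "w x < 0" using x w_f_neg by (auto simp: Q_def)
    define z where "z = (if w x \<le> w (f x) then f x else x)"
    have z: "0 < z" "w z < 0" "w x \<le> w z" "w (f x) \<le> w z" using x pos by (auto simp: z_def Q_def)
    obtain t where t: "f t = z" using f_onto z by blast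
    have wz: "w z = w (f (t / 2)) + w (f (t / 2))" using w_f_add[of "t / 2" "t / 2"] t by simp
    then have neg: "w (f (t / 2)) < 0" using z(2) by (simp add: double_add_less_zero_iff_single_add_less_zero)
    then have less: "w z < w (f (t / 2))" using wz by simp
    have "w' (f (t / 2)) = 0"
      using le_less_trans[OF z(4) less] neg x
      by (intro coarse_between[of x "t / 2", OF less_imp_le]) (auto simp: Q_def)
    then show ?thesis using neg less z(3) by (intro exI[of _ "t / 2"]) (simp add: Q_def)
  qed
  then obtain \<sigma> where "\<forall>n. Q (\<sigma> n) \<and> w (\<sigma> n) < w (f (\<sigma> (Suc n)))"
    using dependent_nat_choice[of "\<lambda>_. Q" "\<lambda>_ x y. w x < w (f y)"] x0 by blast
  then show ?thesis by (auto simp: tower_def Q_def)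
qed

text \<open>
  Zorn's lemma gives a tower from which nothing descends, contrary to \<open>descends_exists\<close>.
\<close>

lemma no_tower_if_chains_bounded:
  assumes bound: "\<And>S. S \<subseteq> Collect tower \<Longrightarrow> S \<noteq> {} \<Longrightarrow>
      (\<And>\<sigma> \<tau>. \<sigma> \<in> S \<Longrightarrow> \<tau> \<in> S \<Longrightarrow> \<sigma> = \<tau> \<or> descends \<sigma> \<tau> \<or> descends \<tau> \<sigma>) \<Longrightarrow>
      \<exists>\<tau>. \<forall>\<sigma>\<in>S. descends \<sigma> \<tau>"
  shows "\<nexists>\<sigma>. tower \<sigma>"
proof
  assume ex: "\<exists>\<sigma>. tower \<sigma>"
  define P where "P \<sigma> \<tau> \<longleftrightarrow> \<sigma> = \<tau> \<or> descends \<sigma> \<tau>" for \<sigma> \<tau>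
  have "partial_order_on (Collect tower) (relation_of P (Collect tower))"
  proof (rule partial_order_on_relation_ofI)
    show "P \<sigma> \<sigma>" for \<sigma> by (simp add: P_def)
    show "P \<sigma> \<rho>" if "\<sigma> \<in> Collect tower" "\<tau> \<in> Collect tower" "\<rho> \<in> Collect tower" "P \<sigma> \<tau>" "P \<tau> \<rho>" for \<sigma> \<tau> \<rho>
      using that descends_trans[of \<sigma> \<tau> \<rho>] by (auto simp: P_def)
    show "\<sigma> = \<tau>" if "\<sigma> \<in> Collect tower" "\<tau> \<in> Collect tower" "P \<sigma> \<tau>" "P \<tau> \<sigma>" for \<sigma> \<tau>
      using that descends_trans[of \<sigma> \<tau> \<sigma>] descends_irrefl[of \<sigma>] by (auto simp: P_def)
  qed
  moreover have "\<exists>\<tau>\<in>Collect tower. \<forall>\<sigma>\<in>S. P \<sigma> \<tau>"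
    if S: "S \<in> Chains (relation_of P (Collect tower))" for S
  proof (cases "S = {}")
    case True
    then show ?thesis using ex by auto
  next
    case False
    have S': "S \<subseteq> Collect tower"
      "\<And>\<sigma> \<tau>. \<sigma> \<in> S \<Longrightarrow> \<tau> \<in> S \<Longrightarrow> \<sigma> = \<tau> \<or> descends \<sigma> \<tau> \<or> descends \<tau> \<sigma>"
      using S by (fastforce simp: Chains_def relation_of_def P_def)+
    obtain \<tau> where \<tau>: "\<forall>\<sigma>\<in>S. descends \<sigma> \<tau>" using bound[OF S'(1) False S'(2)] by blast
    obtain \<sigma> where "\<sigma> \<in> S" using False by blast
    then have "tower \<tau>" using descends_tower(1) \<tau> S'(1) by blast
    then show ?thesis using \<tau> by (auto simp: P_def)
  qed
  ultimately obtain \<mu> where \<mu>: "tower \<mu>" "\<And>\<tau>. tower \<tau> \<Longrightarrow> P \<mu> \<tau> \<Longrightarrow> \<tau> = \<mu>"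
    using predicate_Zorn[of "Collect tower" P] by auto
  obtain \<tau> where \<tau>: "descends \<mu> \<tau>" using descends_exists by blast
  then have "tower \<tau>" "P \<mu> \<tau>" using descends_tower(1) \<mu>(1) by (auto simp: P_def)
  then have "\<tau> = \<mu>" by (rule \<mu>(2))
  then show False using \<tau> descends_irrefl by simp
qed

end

text \<open>
  If all \<open>w'\<close>-units were \<open>w\<close>-units, the valuation ring of the induced valuation would contain all
  nonzero residues together with their inverses.
\<close>

lemma induced_nontrivial_unit:
  fixes w :: "'a::field \<Rightarrow> 'g::linordered_ab_group_add" and w' :: "'a \<Rightarrow> 'h::linordered_ab_group_add"
    and wb :: "'a set \<Rightarrow> 'k::linordered_ab_group_add"
  assumes coarse: "coarsening ring_of_type_algebra w' w"
    and wb: "induced_valuation ring_of_type_algebra w w' wb"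
    and nontrivial: "nontrivial_valuation (residue_field ring_of_type_algebra w') wb"
  shows "\<exists>a. a \<noteq> 0 \<and> w' a = 0 \<and> w a \<noteq> 0"
proof (rule ccontr)
  assume none: "\<not> ?thesis"
  define K where "K = (ring_of_type_algebra :: 'a ring)"
  define k where "k = residue_field K w'"
  have w': "valuation K w'" and kv: "valuation k wb"
    and R: "val_ring k wb = residue K w' ` val_ring K w"
    using coarse wb by (auto simp: coarsening_def induced_valuation_def K_def k_def)
  interpret k: field k using kv by (simp add: valuation_def)
  have nonneg: "0 \<le> wb A" if A: "A \<in> carrier k" "A \<noteq> \<zero>\<^bsub>k\<^esub>" for A
  proof -
    obtain a where a: "a \<in> val_ring K w'" "A = residue K w' a"
      using A(1) unfolding k_def residue_field_simps(1)[OF w'] by blast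
    have "a \<notin> val_ideal K w'"
      using A(2) a residue_zero_iff[OF w' a(1)] by (simp add: k_def residue_field_simps(2)[OF w'])
    then have "a \<noteq> 0" "w' a = 0" using a(1) by (auto simp: K_def val_ring_type val_ideal_type)
    then have "a \<in> val_ring K w" using none by (auto simp: K_def val_ring_type)
    then have "A \<in> val_ring k wb" using R a(2) by blast
    then show ?thesis using A by (simp add: val_ring_def)
  qed
  have "wb A = 0" if A: "A \<in> carrier k" "A \<noteq> \<zero>\<^bsub>k\<^esub>" for A
    using nonneg[OF A] nonneg[of "inv\<^bsub>k\<^esub> A"] val_inv[OF kv A] by auto
  then have "value_group k wb = {0}"
    using k.one_closed k.zero_not_one by (auto simp: value_group_def image_iff intro!: bexI[of _ "\<one>\<^bsub>k\<^esub>"])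
  then show False using nontrivial by (simp add: nontrivial_valuation_def k_def K_def)
qed

text \<open>
  In coordinate \<open>n\<close>, the elements to which \<open>\<sigma>\<close> may descend form the open ball around
  \<open>\<sigma> n - f (\<sigma> (Suc n))\<close> with radius given by \<open>f (\<sigma> (Suc n))\<close>. Along a chain of towers these balls are nested.
\<close>

lemma (in compatible_exponential) not_maximal:
  fixes wb :: "'a set \<Rightarrow> 'k::linordered_ab_group_add"
  assumes wb: "induced_valuation ring_of_type_algebra w w' wb"
    and nontrivial: "nontrivial_valuation (residue_field ring_of_type_algebra w') wb"
  shows "\<not> maximal_valued_field (residue_field ring_of_type_algebra w') wb"
proof
  assume maximal: "maximal_valued_field (residue_field ring_of_type_algebra w') wb"
  have "\<exists>\<tau>. \<forall>\<sigma>\<in>S. descends \<sigma> \<tau>"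
    if S: "S \<subseteq> Collect tower" "S \<noteq> {}"
      "\<And>\<sigma> \<tau>. \<sigma> \<in> S \<Longrightarrow> \<tau> \<in> S \<Longrightarrow> \<sigma> = \<tau> \<or> descends \<sigma> \<tau> \<or> descends \<tau> \<sigma>" for S
  proof -
    have "\<exists>t. \<forall>\<sigma>\<in>S. \<sigma> n - t \<doteq> f (\<sigma> (Suc n))" for n
    proof -
      define r where "r \<sigma> = f (\<sigma> (Suc n))" for \<sigma>
      define c where "c \<sigma> = \<sigma> n - r \<sigma>" for \<sigma>
      have r: "r \<sigma> \<noteq> 0" for \<sigma> by (simp add: r_def)
      have wr: "w' (r \<sigma>) = 0" if "\<sigma> \<in> S" for \<sigma> using S(1) that by (auto simp: tower_def r_def)
      have step: "c \<tau> - c \<sigma> \<lless> r \<sigma> \<and> r \<tau> \<lless> r \<sigma>" if "\<sigma> \<in> S" "descends \<sigma> \<tau>" for \<sigma> \<tau>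
      proof
        show less: "r \<tau> \<lless> r \<sigma>"
          using descends_tower(2)[of \<sigma> \<tau> "Suc n"] that S(1) by (auto simp: below_def r_def)
        have "(\<sigma> n - \<tau> n) - r \<sigma> \<lless> r \<sigma>" using that(2) by (simp add: descends_def close_def r_def)
        then have "r \<tau> + ((\<sigma> n - \<tau> n) - r \<sigma>) \<lless> r \<sigma>" using less by (intro below_add)
        then show "c \<tau> - c \<sigma> \<lless> r \<sigma>"
          by (subst below_diff_commute) (simp add: c_def algebra_simps)
      qed
      \<comment> \<open>The entries \<open>\<sigma> n\<close> may lie outside the valuation ring of \<open>w'\<close>; translation by one centre moves all centres into it.\<close>
      obtain \<sigma>0 where \<sigma>0: "\<sigma>0 \<in> S" using S(2) by blast
      define ball where "ball \<sigma> = {x. x - (c \<sigma> - c \<sigma>0) \<lless> r \<sigma>}" for \<sigma>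
      have mono: "ball \<tau> \<subseteq> ball \<sigma>" if st: "\<sigma> \<in> S" "descends \<sigma> \<tau>" for \<sigma> \<tau>
      proof
        fix x assume "x \<in> ball \<tau>"
        then have "x - (c \<tau> - c \<sigma>0) \<lless> r \<sigma>" using step[OF st] below_trans by (auto simp: ball_def)
        then have "(x - (c \<tau> - c \<sigma>0)) + (c \<tau> - c \<sigma>) \<lless> r \<sigma>" using step[OF st] by (intro below_add) auto
        then show "x \<in> ball \<sigma>" by (simp add: ball_def algebra_simps)
      qed
      have below_nonneg: "x = 0 \<or> 0 \<le> w' x" if "x \<lless> r \<sigma>" "\<sigma> \<in> S" for x \<sigma>
        using that wr coarsening_le[OF coarse r[of \<sigma>], of x]
        by (cases "x = 0") (auto simp: below_def order_less_imp_le)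
      have center: "c \<sigma> - c \<sigma>0 = 0 \<or> 0 \<le> w' (c \<sigma> - c \<sigma>0)" if \<sigma>: "\<sigma> \<in> S" for \<sigma>
        using S(3)[OF \<sigma> \<sigma>0] step[OF \<sigma>, of \<sigma>0] step[OF \<sigma>0, of \<sigma>]
          below_nonneg[OF _ \<sigma>, of "c \<sigma> - c \<sigma>0"] below_nonneg[OF _ \<sigma>0, of "c \<sigma> - c \<sigma>0"]
          below_diff_commute[of "c \<sigma>" "c \<sigma>0" "r \<sigma>"] by auto
      have "\<Inter>(ball ` S) \<noteq> {}"
      proof (rule maximal_residue_ball_nest[OF infinite_UNIV_char_0 coarse wb maximal])
        show "ball ` S \<noteq> {}" using S(2) by simp
        show "A \<subseteq> B \<or> B \<subseteq> A" if "A \<in> ball ` S" "B \<in> ball ` S" for A B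
          using that mono S(3) by (metis imageE order_refl)
        show "\<exists>c r. r \<noteq> 0 \<and> w' r = 0 \<and> (c = 0 \<or> 0 \<le> w' c) \<and> B = {x. x - c \<lless> r}"
          if B: "B \<in> ball ` S" for B
        proof -
          obtain \<sigma> where \<sigma>: "\<sigma> \<in> S" "B = ball \<sigma>" using B by blast
          then show ?thesis
            using r wr center by (intro exI[of _ "c \<sigma> - c \<sigma>0"] exI[of _ "r \<sigma>"]) (auto simp: ball_def)
        qed
      qed
      then obtain y where y: "\<And>\<sigma>. \<sigma> \<in> S \<Longrightarrow> y - (c \<sigma> - c \<sigma>0) \<lless> r \<sigma>" by (auto simp: ball_def)
      have "\<sigma> n - (y + c \<sigma>0) \<doteq> f (\<sigma> (Suc n))" if "\<sigma> \<in> S" for \<sigma>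
      proof -
        have "(c \<sigma> - c \<sigma>0) - y \<lless> r \<sigma>" using y[OF that] below_diff_commute by blast
        moreover have "(c \<sigma> - c \<sigma>0) - y = (\<sigma> n - (y + c \<sigma>0)) - r \<sigma>" by (simp add: c_def)
        ultimately show ?thesis by (simp only: close_def r_def)
      qed
      then show ?thesis by blast
    qed
    then show ?thesis unfolding descends_def by metis
  qed
  then have "\<nexists>\<sigma>. tower \<sigma>" by (rule no_tower_if_chains_bounded)
  then show False using induced_nontrivial_unit[OF coarse wb nontrivial] tower_exists by blast
qed

theorem theorem8:
  fixes f :: "'a::linordered_field \<Rightarrow> 'a"
    and w :: "'a \<Rightarrow> 'g::linordered_ab_group_add"
  assumes "exponential f"
    and "coarsening ring_of_type_algebra w natural_valuation"
    and "compatible f w"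
  shows "\<not> (\<exists>(w' :: 'a \<Rightarrow> 'h::linordered_ab_group_add)
              (wb :: 'a set \<Rightarrow> 'k::linordered_ab_group_add).
            coarsening ring_of_type_algebra w' w \<and>
            induced_valuation ring_of_type_algebra w w' wb \<and>
            nontrivial_valuation (residue_field ring_of_type_algebra w') wb \<and>
            maximal_valued_field (residue_field ring_of_type_algebra w') wb)"
proof clarify
  fix w' :: "'a \<Rightarrow> 'h" and wb :: "'a set \<Rightarrow> 'k"
  assume "coarsening ring_of_type_algebra w' w"
    and wb: "induced_valuation ring_of_type_algebra w w' wb"
      "nontrivial_valuation (residue_field ring_of_type_algebra w') wb"
      "maximal_valued_field (residue_field ring_of_type_algebra w') wb"
  then interpret compatible_exponential f w w' using assms by unfold_locales
  show False using not_maximal wb by blast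
qed

end
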